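(* Let $T=(\Sigma_S,\mathsf{Init},\mathsf{Update})$ be a transition system with theory $\mathcal{T}_S=\mathcal{T}_0\cup\mathcal{K}$, where $\mathcal{T}_0$ is the disjoint combination of Presburger arithmetic (sort index) and a theory of elements (e.g. linear arithmetic over $\mathbb{Q}$). Assume that all functions in $\Sigma$ are unary. If $\mathcal{K}$, $\mathsf{Init}$, $\mathsf{Update}$ and $\Psi$ are in the array property fragment and all clauses in $\Psi$ have only one universally quantified variable, then the formulae $\Gamma_n$ obtained by symbol elimination at every iteration of Algorithm 2 are again in the array property fragment and are conjunctions of clauses having only one quantified variable.
   Context: Transition system: $\Sigma_S=\Sigma_0\cup\Sigma_P\cup\Sigma$ with $\Sigma_0$ the signature of $\mathcal{T}_0$, $\Sigma_P$ parametric function symbols, $\Sigma$ non-parametric function symbols; $\mathsf{Init}$ universal; $\mathsf{Update}$ a universal formula over $\Sigma_S$ and primed copies $f'$ of updated symbols $f\in F\subseteq\Sigma$, of the form $\mathsf{Update}_f=\{\forall\overline{x}(\phi_i(\overline{x})\to C_i(\overline{x},f'(\overline{x})))\}$ with mutually exclusive (modulo $\mathcal{T}_S$) and exhaustive conditions $\phi_i$ and conjunctions of literals $C_i$ satisfiable in $y$ whenever $\phi_i$ holds. $\phi'$ replaces each $f\in\Sigma$ by $f'$. $I$ is an inductive invariant if $\mathsf{Init}\models_{\mathcal{T}_S}I$ and $I\wedge\mathsf{Update}\models_{\mathcal{T}_S}I'$. $\Psi$ is a universal formula over $\Sigma_P$. Array property fragment: arrays are functions from the index sort to element sorts. An array property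 formula has the form $\forall i\,(\varphi_I(i)\to\varphi_V(i))$ where $\varphi_I$ is a positive Boolean combination of atoms $t\le u$ or $t=u$ with $t,u$ variables or ground index terms, and in $\varphi_V$ every universally quantified index variable occurs only in direct array reads $a(x)$, with no nested array reads. The fragment consists of all existentially closed Boolean combinations of quantifier-free formulae and array property formulae. Algorithm 2: $I_1:=\Psi$; at step $n$, if $I_n$ is an inductive invariant return it; if $\mathsf{Init}\not\models_{\mathcal{T}_S}I_n$ return ``no universal inductive invariant over $\Sigma_P$ entails $\Psi$''; otherwise compute $\Gamma_n$ by eliminating all primed symbols and all symbols not in $\Sigma_P$ from $I_n\wedge\mathsf{Update}\wedge\neg I_n'$ and set $I_{n+1}:=I_n\wedge\Gamma_n$. Symbol elimination: Skolemize, instantiate the axioms at the occurring extension ground terms, purify by replacing extension ground terms by fresh constants and adding instances of congruence axioms, existentially quantify the constants to be eliminated (those not parameters, not standing for terms $g(\overline c)$ with $g\in\Sigma_P$, and not arguments of such terms), eliminate them by quantifier elimination in $\mathcal{T}_0$, replace constants back by the terms $g(\overline c)$, replace remaining Skolem constants by existential variables $\overline y$, and negate to get $\forall\overline y\,\neg(\cdots)$. *)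

theory Defs
  imports Main
begin

section \<open>Syntax\<close>

text \<open>Index terms are linear integer terms over leaves of type \<open>'k\<close>; element terms are terms over
  an arbitrary signature \<open>'f\<close> with leaves of type \<open>'l\<close>.  A quantifier-free formula whose leaves are
  regarded as variables (free constants) is a formula of the base theory.  Formulas of the extended
  theory are the instances where an element leaf is an element variable or an application \<open>Rd a ts\<close>
  of an uninterpreted function (an array) to index terms.  Thus the name of the fresh constant that
  purification introduces for a ground term \<open>a(ts)\<close> is the leaf \<open>Rd a ts\<close> itself.
  Divisibility by a constant belongs to the signature of Presburger arithmetic, as quantifier
  elimination needs it.\<close>

datatype 'k iterm =
  ILeaf 'k
| INum int
| IAdd "'k iterm" "'k iterm"
| IMul int "'k iterm"

datatype ('l, 'f) eterm =
  ELeaf 'l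
| EFn 'f "('l, 'f) eterm list"

datatype ('k, 'l, 'f, 'p) atom =
  ILe "'k iterm" "'k iterm"
| IEq "'k iterm" "'k iterm"
| IDvd int "'k iterm"
| EEq "('l, 'f) eterm" "('l, 'f) eterm"
| EPr 'p "('l, 'f) eterm list"

datatype (ixs: 'k, els: 'l, 'f, 'p) qf =
  Tru
| Fls
| At "('k, 'l, 'f, 'p) atom"
| Neg "('k, 'l, 'f, 'p) qf"
| Conj "('k, 'l, 'f, 'p) qf" "('k, 'l, 'f, 'p) qf"
| Disj "('k, 'l, 'f, 'p) qf" "('k, 'l, 'f, 'p) qf"
| Imp "('k, 'l, 'f, 'p) qf" "('k, 'l, 'f, 'p) qf"

text \<open>\<open>Con c\<close> is an uninterpreted constant of sort index, \<open>Sk n\<close> the Skolem constant for the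
  universally quantified index variable \<open>Var n\<close>.\<close>

datatype 'c ileaf = Var nat | Con 'c | Sk nat

text \<open>\<open>Nxt a\<close> is the primed copy of \<open>a\<close>.\<close>

datatype 'a psym = Cur (base: 'a) | Nxt (base: 'a)

datatype ('c, 'a, 's) eleaf =
  EV 's nat
| Rd "'a psym" "'c ileaf iterm list"

type_synonym ('c, 'a, 's, 'f, 'p) xqf = "('c ileaf, ('c, 'a, 's) eleaf, 'f, 'p) qf"

text \<open>Uninterpreted symbols: constants of sort index, and functions from the index sort to an
  element sort.  Constants of an element sort are functions of arity 0.\<close>

datatype ('c, 'a) sym = IxC 'c | Arr 'a

record ('a, 's, 'f, 'p) signature =
  arity :: "'a \<Rightarrow> nat"
  rsort :: "'a \<Rightarrow> 's"
  fsorts :: "'f \<Rightarrow> 's list \<times> 's"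
  psorts :: "'p \<Rightarrow> 's list"

fun sym_arity :: "('a, 's, 'f, 'p) signature \<Rightarrow> ('c, 'a) sym \<Rightarrow> nat" where
  "sym_arity Sg (IxC c) = 0"
| "sym_arity Sg (Arr a) = arity Sg a"

text \<open>A universally quantified conjunct \<open>(k, M)\<close> stands for
  \<open>\<forall>x\<^sub>0 \<dots> x\<^sub>k\<^sub>-\<^sub>1. M\<close>; a universal formula is the conjunction of a list of these.\<close>

type_synonym ('c, 'a, 's, 'f, 'p) uclause = "nat \<times> ('c, 'a, 's, 'f, 'p) xqf"

datatype ('c, 'a, 's, 'f, 'p) fm =
  Qf "('c, 'a, 's, 'f, 'p) xqf"
| FNeg "('c, 'a, 's, 'f, 'p) fm"
| FConj "('c, 'a, 's, 'f, 'p) fm" "('c, 'a, 's, 'f, 'p) fm"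
| FDisj "('c, 'a, 's, 'f, 'p) fm" "('c, 'a, 's, 'f, 'p) fm"
| AllI nat "('c, 'a, 's, 'f, 'p) fm"
| ExI nat "('c, 'a, 's, 'f, 'p) fm"
| ExE 's nat "('c, 'a, 's, 'f, 'p) fm"

definition conj_list :: "('k, 'l, 'f, 'p) qf list \<Rightarrow> ('k, 'l, 'f, 'p) qf" where
  "conj_list \<phi>s = foldr Conj \<phi>s Tru"

definition disj_list :: "('k, 'l, 'f, 'p) qf list \<Rightarrow> ('k, 'l, 'f, 'p) qf" where
  "disj_list \<phi>s = foldr Disj \<phi>s Fls"

definition alls :: "nat list \<Rightarrow> ('c, 'a, 's, 'f, 'p) fm \<Rightarrow> ('c, 'a, 's, 'f, 'p) fm" where
  "alls vs \<phi> = foldr AllI vs \<phi>"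

fun clause_fm :: "('c, 'a, 's, 'f, 'p) uclause \<Rightarrow> ('c, 'a, 's, 'f, 'p) fm" where
  "clause_fm (k, M) = alls [0..<k] (Qf M)"

definition univ_fm :: "('c, 'a, 's, 'f, 'p) uclause list \<Rightarrow> ('c, 'a, 's, 'f, 'p) fm" where
  "univ_fm cls = foldr FConj (map clause_fm cls) (Qf Tru)"


section \<open>Substitution, occurrences, well-formedness\<close>

primrec isubst :: "('k \<Rightarrow> 'm iterm) \<Rightarrow> 'k iterm \<Rightarrow> 'm iterm" where
  "isubst \<sigma> (ILeaf k) = \<sigma> k"
| "isubst \<sigma> (INum z) = INum z"
| "isubst \<sigma> (IAdd t u) = IAdd (isubst \<sigma> t) (isubst \<sigma> u)"
| "isubst \<sigma> (IMul z t) = IMul z (isubst \<sigma> t)"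

primrec asubst :: "('k \<Rightarrow> 'm iterm) \<Rightarrow> ('l \<Rightarrow> 'n) \<Rightarrow> ('k, 'l, 'f, 'p) atom \<Rightarrow> ('m, 'n, 'f, 'p) atom"
  where
  "asubst \<sigma> \<tau> (ILe t u) = ILe (isubst \<sigma> t) (isubst \<sigma> u)"
| "asubst \<sigma> \<tau> (IEq t u) = IEq (isubst \<sigma> t) (isubst \<sigma> u)"
| "asubst \<sigma> \<tau> (IDvd d t) = IDvd d (isubst \<sigma> t)"
| "asubst \<sigma> \<tau> (EEq t u) = EEq (map_eterm \<tau> id t) (map_eterm \<tau> id u)"
| "asubst \<sigma> \<tau> (EPr p ts) = EPr p (map (map_eterm \<tau> id) ts)"

primrec qsubst :: "('k \<Rightarrow> 'm iterm) \<Rightarrow> ('l \<Rightarrow> 'n) \<Rightarrow> ('k, 'l, 'f, 'p) qf \<Rightarrow> ('m, 'n, 'f, 'p) qf"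
  where
  "qsubst \<sigma> \<tau> Tru = Tru"
| "qsubst \<sigma> \<tau> Fls = Fls"
| "qsubst \<sigma> \<tau> (At a) = At (asubst \<sigma> \<tau> a)"
| "qsubst \<sigma> \<tau> (Neg \<phi>) = Neg (qsubst \<sigma> \<tau> \<phi>)"
| "qsubst \<sigma> \<tau> (Conj \<phi> \<psi>) = Conj (qsubst \<sigma> \<tau> \<phi>) (qsubst \<sigma> \<tau> \<psi>)"
| "qsubst \<sigma> \<tau> (Disj \<phi> \<psi>) = Disj (qsubst \<sigma> \<tau> \<phi>) (qsubst \<sigma> \<tau> \<psi>)"
| "qsubst \<sigma> \<tau> (Imp \<phi> \<psi>) = Imp (qsubst \<sigma> \<tau> \<phi>) (qsubst \<sigma> \<tau> \<psi>)"

primrec lsubst :: "('c ileaf \<Rightarrow> 'c ileaf iterm) \<Rightarrow> ('c, 'a, 's) eleaf \<Rightarrow> ('c, 'a, 's) eleaf" where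
  "lsubst \<sigma> (EV s n) = EV s n"
| "lsubst \<sigma> (Rd a ts) = Rd a (map (isubst \<sigma>) ts)"

definition xsubst ::
  "('c ileaf \<Rightarrow> 'c ileaf iterm) \<Rightarrow> ('c, 'a, 's, 'f, 'p) xqf \<Rightarrow> ('c, 'a, 's, 'f, 'p) xqf" where
  "xsubst \<sigma> = qsubst \<sigma> (lsubst \<sigma>)"

primrec arg_leaves :: "('c, 'a, 's) eleaf \<Rightarrow> 'c ileaf set" where
  "arg_leaves (EV s n) = {}"
| "arg_leaves (Rd a ts) = (\<Union>t\<in>set ts. set_iterm t)"

definition ileaves :: "('c, 'a, 's, 'f, 'p) xqf \<Rightarrow> 'c ileaf set" where
  "ileaves M = ixs M \<union> (\<Union>l\<in>els M. arg_leaves l)"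

primrec leaf_sort :: "('a, 's, 'f, 'p) signature \<Rightarrow> ('c, 'a, 's) eleaf \<Rightarrow> 's" where
  "leaf_sort Sg (EV s n) = s"
| "leaf_sort Sg (Rd a ts) = rsort Sg (base a)"

primrec esort :: "('a, 's, 'f, 'p) signature \<Rightarrow> ('l \<Rightarrow> 's) \<Rightarrow> ('l, 'f) eterm \<Rightarrow> 's option" where
  "esort Sg ls (ELeaf l) = Some (ls l)"
| "esort Sg ls (EFn f ts) =
    (if map (esort Sg ls) ts = map Some (fst (fsorts Sg f)) then Some (snd (fsorts Sg f)) else None)"

primrec wt_atom :: "('a, 's, 'f, 'p) signature \<Rightarrow> ('l \<Rightarrow> 's) \<Rightarrow> ('k, 'l, 'f, 'p) atom \<Rightarrow> bool" where
  "wt_atom Sg ls (ILe t u) = True"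
| "wt_atom Sg ls (IEq t u) = True"
| "wt_atom Sg ls (IDvd d t) = True"
| "wt_atom Sg ls (EEq t u) = (\<exists>s. esort Sg ls t = Some s \<and> esort Sg ls u = Some s)"
| "wt_atom Sg ls (EPr p ts) = (map (esort Sg ls) ts = map Some (psorts Sg p))"

primrec wt_qf :: "('a, 's, 'f, 'p) signature \<Rightarrow> ('l \<Rightarrow> 's) \<Rightarrow> ('k, 'l, 'f, 'p) qf \<Rightarrow> bool" where
  "wt_qf Sg ls Tru = True"
| "wt_qf Sg ls Fls = True"
| "wt_qf Sg ls (At a) = wt_atom Sg ls a"
| "wt_qf Sg ls (Neg \<phi>) = wt_qf Sg ls \<phi>"
| "wt_qf Sg ls (Conj \<phi> \<psi>) = (wt_qf Sg ls \<phi> \<and> wt_qf Sg ls \<psi>)"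
| "wt_qf Sg ls (Disj \<phi> \<psi>) = (wt_qf Sg ls \<phi> \<and> wt_qf Sg ls \<psi>)"
| "wt_qf Sg ls (Imp \<phi> \<psi>) = (wt_qf Sg ls \<phi> \<and> wt_qf Sg ls \<psi>)"

text \<open>\<open>wf_matrix Sg S Y k M\<close>: \<open>M\<close> is well-sorted and built from interpreted symbols, unprimed
  uninterpreted symbols in \<open>S\<close>, the index variables \<open>x\<^sub>0, \<dots>, x\<^sub>k\<^sub>-\<^sub>1\<close>
  and the element variables in \<open>Y\<close>.\<close>

definition wf_matrix :: "('a, 's, 'f, 'p) signature \<Rightarrow> ('c, 'a) sym set \<Rightarrow> ('s \<times> nat) set \<Rightarrow> nat \<Rightarrow>
    ('c, 'a, 's, 'f, 'p) xqf \<Rightarrow> bool" where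
  "wf_matrix Sg S Y k M \<longleftrightarrow>
    wt_qf Sg (leaf_sort Sg) M \<and>
    (\<forall>l\<in>ileaves M. case l of Var n \<Rightarrow> n < k | Con c \<Rightarrow> IxC c \<in> S | Sk n \<Rightarrow> False) \<and>
    (\<forall>l\<in>els M. case l of
        EV s n \<Rightarrow> (s, n) \<in> Y
      | Rd a ts \<Rightarrow> (\<exists>b. a = Cur b \<and> Arr b \<in> S \<and> length ts = arity Sg b))"

definition wf_clauses :: "('a, 's, 'f, 'p) signature \<Rightarrow> ('c, 'a) sym set \<Rightarrow>
    ('c, 'a, 's, 'f, 'p) uclause list \<Rightarrow> bool" where
  "wf_clauses Sg S cls \<longleftrightarrow> (\<forall>(k, M)\<in>set cls. wf_matrix Sg S {} k M)"


section \<open>The array property fragment\<close>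

text \<open>In the following \<open>V\<close> is the set of universally quantified index variables; a term is ground if
  no variable of \<open>V\<close> occurs in it.\<close>

definition ground_over :: "nat set \<Rightarrow> 'c ileaf iterm \<Rightarrow> bool" where
  "ground_over V t \<longleftrightarrow> set_iterm t \<inter> Var ` V = {}"

definition var_or_ground :: "nat set \<Rightarrow> 'c ileaf iterm \<Rightarrow> bool" where
  "var_or_ground V t \<longleftrightarrow> (\<exists>v\<in>V. t = ILeaf (Var v)) \<or> ground_over V t"

fun index_guard :: "nat set \<Rightarrow> ('c, 'a, 's, 'f, 'p) xqf \<Rightarrow> bool" where
  "index_guard V Tru = True"
| "index_guard V (At (ILe t u)) = (var_or_ground V t \<and> var_or_ground V u)"
| "index_guard V (At (IEq t u)) = (var_or_ground V t \<and> var_or_ground V u)"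
| "index_guard V (Conj \<phi> \<psi>) = (index_guard V \<phi> \<and> index_guard V \<psi>)"
| "index_guard V (Disj \<phi> \<psi>) = (index_guard V \<phi> \<and> index_guard V \<psi>)"
| "index_guard V _ = False"

definition value_constraint :: "nat set \<Rightarrow> ('c, 'a, 's, 'f, 'p) xqf \<Rightarrow> bool" where
  "value_constraint V \<phi> \<longleftrightarrow>
    ixs \<phi> \<inter> Var ` V = {} \<and>
    (\<forall>a ts. Rd a ts \<in> els \<phi> \<longrightarrow> (\<forall>t\<in>set ts. var_or_ground V t))"

inductive array_property :: "('c, 'a, 's, 'f, 'p) fm \<Rightarrow> bool" where
  "index_guard (set vs) \<phi>I \<Longrightarrow> value_constraint (set vs) \<phi>V \<Longrightarrow>
    array_property (alls vs (Qf (Imp \<phi>I \<phi>V)))"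

inductive apf_body :: "('c, 'a, 's, 'f, 'p) fm \<Rightarrow> bool" where
  "apf_body (Qf M)"
| "array_property \<phi> \<Longrightarrow> apf_body \<phi>"
| "apf_body \<phi> \<Longrightarrow> apf_body (FNeg \<phi>)"
| "apf_body \<phi> \<Longrightarrow> apf_body \<psi> \<Longrightarrow> apf_body (FConj \<phi> \<psi>)"
| "apf_body \<phi> \<Longrightarrow> apf_body \<psi> \<Longrightarrow> apf_body (FDisj \<phi> \<psi>)"

inductive ex_apf :: "('c, 'a, 's, 'f, 'p) fm \<Rightarrow> bool" where
  "apf_body \<phi> \<Longrightarrow> ex_apf \<phi>"
| "ex_apf \<phi> \<Longrightarrow> ex_apf (ExI n \<phi>)"
| "ex_apf \<phi> \<Longrightarrow> ex_apf (ExE s n \<phi>)"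

primrec free_ivars :: "('c, 'a, 's, 'f, 'p) fm \<Rightarrow> nat set" where
  "free_ivars (Qf M) = {n. Var n \<in> ileaves M}"
| "free_ivars (FNeg \<phi>) = free_ivars \<phi>"
| "free_ivars (FConj \<phi> \<psi>) = free_ivars \<phi> \<union> free_ivars \<psi>"
| "free_ivars (FDisj \<phi> \<psi>) = free_ivars \<phi> \<union> free_ivars \<psi>"
| "free_ivars (AllI n \<phi>) = free_ivars \<phi> - {n}"
| "free_ivars (ExI n \<phi>) = free_ivars \<phi> - {n}"
| "free_ivars (ExE s n \<phi>) = free_ivars \<phi>"

primrec free_evars :: "('c, 'a, 's, 'f, 'p) fm \<Rightarrow> ('s \<times> nat) set" where
  "free_evars (Qf M) = {(s, n). EV s n \<in> els M}"
| "free_evars (FNeg \<phi>) = free_evars \<phi>"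
| "free_evars (FConj \<phi> \<psi>) = free_evars \<phi> \<union> free_evars \<psi>"
| "free_evars (FDisj \<phi> \<psi>) = free_evars \<phi> \<union> free_evars \<psi>"
| "free_evars (AllI n \<phi>) = free_evars \<phi>"
| "free_evars (ExI n \<phi>) = free_evars \<phi>"
| "free_evars (ExE s n \<phi>) = free_evars \<phi> - {(s, n)}"

definition array_property_fragment :: "('c, 'a, 's, 'f, 'p) fm \<Rightarrow> bool" where
  "array_property_fragment \<phi> \<longleftrightarrow> ex_apf \<phi> \<and> free_ivars \<phi> = {} \<and> free_evars \<phi> = {}"

text \<open>Clauses, written as \<open>\<And> atoms \<longrightarrow> \<Or> literals\<close> or as \<open>\<Or> literals\<close>.\<close>

fun atom_conj :: "('k, 'l, 'f, 'p) qf \<Rightarrow> bool" where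
  "atom_conj Tru = True"
| "atom_conj (At a) = True"
| "atom_conj (Conj \<phi> \<psi>) = (atom_conj \<phi> \<and> atom_conj \<psi>)"
| "atom_conj _ = False"

fun literal :: "('k, 'l, 'f, 'p) qf \<Rightarrow> bool" where
  "literal (At a) = True"
| "literal (Neg (At a)) = True"
| "literal _ = False"

fun literal_disj :: "('k, 'l, 'f, 'p) qf \<Rightarrow> bool" where
  "literal_disj Fls = True"
| "literal_disj (Disj \<phi> \<psi>) = (literal_disj \<phi> \<and> literal_disj \<psi>)"
| "literal_disj \<phi> = literal \<phi>"

fun clausal :: "('k, 'l, 'f, 'p) qf \<Rightarrow> bool" where
  "clausal (Imp \<phi> \<psi>) = (atom_conj \<phi> \<and> literal_disj \<psi>)"
| "clausal \<phi> = literal_disj \<phi>"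

text \<open>At most one variable is allowed, so that ground clauses are included.\<close>

definition one_var_clauses :: "('c, 'a, 's, 'f, 'p) uclause list \<Rightarrow> bool" where
  "one_var_clauses cls \<longleftrightarrow> (\<forall>(k, M)\<in>set cls. k \<le> 1 \<and> clausal M)"


section \<open>Semantics\<close>

text \<open>A theory of elements is given by its class of (many-sorted) models, with carriers inside the
  type \<open>'u\<close>.  The index sort is interpreted by the integers.  The base theory, the disjoint
  combination of both, has as models the pairs of the integers and a model of the theory of
  elements.\<close>

record ('s, 'f, 'p, 'u) estruct =
  carr :: "'s \<Rightarrow> 'u set"
  fint :: "'f \<Rightarrow> 'u list \<Rightarrow> 'u"
  pint :: "'p \<Rightarrow> 'u list \<Rightarrow> bool"

definition element_theory ::
  "('a, 's, 'f, 'p) signature \<Rightarrow> ('s, 'f, 'p, 'u) estruct set \<Rightarrow> bool" where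
  "element_theory Sg TE \<longleftrightarrow> (\<forall>E\<in>TE.
    (\<forall>s. carr E s \<noteq> {}) \<and>
    (\<forall>f us. list_all2 (\<lambda>u s. u \<in> carr E s) us (fst (fsorts Sg f)) \<longrightarrow>
      fint E f us \<in> carr E (snd (fsorts Sg f))))"

primrec ieval :: "('k \<Rightarrow> int) \<Rightarrow> 'k iterm \<Rightarrow> int" where
  "ieval \<iota> (ILeaf k) = \<iota> k"
| "ieval \<iota> (INum z) = z"
| "ieval \<iota> (IAdd t u) = ieval \<iota> t + ieval \<iota> u"
| "ieval \<iota> (IMul z t) = z * ieval \<iota> t"

primrec eeval :: "('s, 'f, 'p, 'u) estruct \<Rightarrow> ('l \<Rightarrow> 'u) \<Rightarrow> ('l, 'f) eterm \<Rightarrow> 'u" where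
  "eeval E \<nu> (ELeaf l) = \<nu> l"
| "eeval E \<nu> (EFn f ts) = fint E f (map (eeval E \<nu>) ts)"

primrec aeval :: "('s, 'f, 'p, 'u) estruct \<Rightarrow> ('k \<Rightarrow> int) \<Rightarrow> ('l \<Rightarrow> 'u) \<Rightarrow>
    ('k, 'l, 'f, 'p) atom \<Rightarrow> bool" where
  "aeval E \<iota> \<nu> (ILe t u) = (ieval \<iota> t \<le> ieval \<iota> u)"
| "aeval E \<iota> \<nu> (IEq t u) = (ieval \<iota> t = ieval \<iota> u)"
| "aeval E \<iota> \<nu> (IDvd d t) = (d dvd ieval \<iota> t)"
| "aeval E \<iota> \<nu> (EEq t u) = (eeval E \<nu> t = eeval E \<nu> u)"
| "aeval E \<iota> \<nu> (EPr p ts) = pint E p (map (eeval E \<nu>) ts)"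

primrec qeval :: "('s, 'f, 'p, 'u) estruct \<Rightarrow> ('k \<Rightarrow> int) \<Rightarrow> ('l \<Rightarrow> 'u) \<Rightarrow>
    ('k, 'l, 'f, 'p) qf \<Rightarrow> bool" where
  "qeval E \<iota> \<nu> Tru = True"
| "qeval E \<iota> \<nu> Fls = False"
| "qeval E \<iota> \<nu> (At a) = aeval E \<iota> \<nu> a"
| "qeval E \<iota> \<nu> (Neg \<phi>) = (\<not> qeval E \<iota> \<nu> \<phi>)"
| "qeval E \<iota> \<nu> (Conj \<phi> \<psi>) = (qeval E \<iota> \<nu> \<phi> \<and> qeval E \<iota> \<nu> \<psi>)"
| "qeval E \<iota> \<nu> (Disj \<phi> \<psi>) = (qeval E \<iota> \<nu> \<phi> \<or> qeval E \<iota> \<nu> \<psi>)"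
| "qeval E \<iota> \<nu> (Imp \<phi> \<psi>) = (qeval E \<iota> \<nu> \<phi> \<longrightarrow> qeval E \<iota> \<nu> \<psi>)"

text \<open>In the extended theory the leaf \<open>Rd a ts\<close> is evaluated by applying the interpretation of
  \<open>a\<close>.\<close>

primrec read_val :: "('a psym \<Rightarrow> int list \<Rightarrow> 'u) \<Rightarrow> ('c ileaf \<Rightarrow> int) \<Rightarrow> ('s \<Rightarrow> nat \<Rightarrow> 'u) \<Rightarrow>
    ('c, 'a, 's) eleaf \<Rightarrow> 'u" where
  "read_val A \<iota> \<epsilon> (EV s n) = \<epsilon> s n"
| "read_val A \<iota> \<epsilon> (Rd a ts) = A a (map (ieval \<iota>) ts)"

primrec fmeval :: "('s, 'f, 'p, 'u) estruct \<Rightarrow> ('a psym \<Rightarrow> int list \<Rightarrow> 'u) \<Rightarrow> ('c ileaf \<Rightarrow> int) \<Rightarrow>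
    ('s \<Rightarrow> nat \<Rightarrow> 'u) \<Rightarrow> ('c, 'a, 's, 'f, 'p) fm \<Rightarrow> bool" where
  "fmeval E A \<iota> \<epsilon> (Qf M) = qeval E \<iota> (read_val A \<iota> \<epsilon>) M"
| "fmeval E A \<iota> \<epsilon> (FNeg \<phi>) = (\<not> fmeval E A \<iota> \<epsilon> \<phi>)"
| "fmeval E A \<iota> \<epsilon> (FConj \<phi> \<psi>) = (fmeval E A \<iota> \<epsilon> \<phi> \<and> fmeval E A \<iota> \<epsilon> \<psi>)"
| "fmeval E A \<iota> \<epsilon> (FDisj \<phi> \<psi>) = (fmeval E A \<iota> \<epsilon> \<phi> \<or> fmeval E A \<iota> \<epsilon> \<psi>)"
| "fmeval E A \<iota> \<epsilon> (AllI n \<phi>) = (\<forall>z. fmeval E A (\<iota>(Var n := z)) \<epsilon> \<phi>)"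
| "fmeval E A \<iota> \<epsilon> (ExI n \<phi>) = (\<exists>z. fmeval E A (\<iota>(Var n := z)) \<epsilon> \<phi>)"
| "fmeval E A \<iota> \<epsilon> (ExE s n \<phi>) = (\<exists>u\<in>carr E s. fmeval E A \<iota> (\<epsilon>(s := (\<epsilon> s)(n := u))) \<phi>)"

definition sorted_interp :: "('a, 's, 'f, 'p) signature \<Rightarrow> ('s, 'f, 'p, 'u) estruct \<Rightarrow>
    ('a psym \<Rightarrow> int list \<Rightarrow> 'u) \<Rightarrow> ('s \<Rightarrow> nat \<Rightarrow> 'u) \<Rightarrow> bool" where
  "sorted_interp Sg E A \<epsilon> \<longleftrightarrow>
    (\<forall>a zs. A a zs \<in> carr E (rsort Sg (base a))) \<and> (\<forall>s n. \<epsilon> s n \<in> carr E s)"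

text \<open>Entailment modulo the extension of the base theory with free function symbols; the axioms
  \<open>\<K>\<close> of the theory extension are passed among the premises \<open>\<Phi>\<close>.\<close>

definition entails :: "('a, 's, 'f, 'p) signature \<Rightarrow> ('s, 'f, 'p, 'u) estruct set \<Rightarrow>
    ('c, 'a, 's, 'f, 'p) fm set \<Rightarrow> ('c, 'a, 's, 'f, 'p) fm \<Rightarrow> bool" where
  "entails Sg TE \<Phi> \<psi> \<longleftrightarrow> (\<forall>E\<in>TE. \<forall>A \<iota> \<epsilon>. sorted_interp Sg E A \<epsilon> \<longrightarrow>
    (\<forall>\<phi>\<in>\<Phi>. fmeval E A \<iota> \<epsilon> \<phi>) \<longrightarrow> fmeval E A \<iota> \<epsilon> \<psi>)"

definition equivalent :: "('a, 's, 'f, 'p) signature \<Rightarrow> ('s, 'f, 'p, 'u) estruct set \<Rightarrow>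
    ('c, 'a, 's, 'f, 'p) fm \<Rightarrow> ('c, 'a, 's, 'f, 'p) fm \<Rightarrow> bool" where
  "equivalent Sg TE \<phi> \<psi> \<longleftrightarrow> entails Sg TE {\<phi>} \<psi> \<and> entails Sg TE {\<psi>} \<phi>"


section \<open>Transition systems\<close>

text \<open>\<open>Param\<close> and \<open>NonParam\<close> are \<open>\<Sigma>\<^sub>P\<close> and \<open>\<Sigma>\<close>; \<open>Upd\<close> is the list of updated
  symbols.  An element \<open>(\<phi>, Cs)\<close> of \<open>rules f\<close> is a condition and the literals of its conclusion, in
  which the element variable \<open>y = EV (rsort f) 0\<close> stands for the new value \<open>f'(x\<^sub>0, \<dots>)\<close>.\<close>

record ('c, 'a, 's, 'f, 'p) transsys =
  Param :: "('c, 'a) sym set"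
  NonParam :: "('c, 'a) sym set"
  Axs :: "('c, 'a, 's, 'f, 'p) uclause list"
  Init :: "('c, 'a, 's, 'f, 'p) uclause list"
  Upd :: "'a list"
  rules :: "'a \<Rightarrow> (('c, 'a, 's, 'f, 'p) xqf \<times> ('c, 'a, 's, 'f, 'p) xqf list) list"

definition subst_new :: "('a, 's, 'f, 'p) signature \<Rightarrow> 'a \<Rightarrow>
    ('c, 'a, 's, 'f, 'p) xqf \<Rightarrow> ('c, 'a, 's, 'f, 'p) xqf" where
  "subst_new Sg f = qsubst ILeaf
    (\<lambda>l. if l = EV (rsort Sg f) 0 then Rd (Nxt f) (map (\<lambda>n. ILeaf (Var n)) [0..<arity Sg f]) else l)"

definition update_of :: "('a, 's, 'f, 'p) signature \<Rightarrow> ('c, 'a, 's, 'f, 'p) transsys \<Rightarrow> 'a \<Rightarrow>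
    ('c, 'a, 's, 'f, 'p) uclause list" where
  "update_of Sg T f =
    map (\<lambda>(\<phi>, Cs). (arity Sg f, Imp \<phi> (subst_new Sg f (conj_list Cs)))) (rules T f)"

definition Update :: "('a, 's, 'f, 'p) signature \<Rightarrow> ('c, 'a, 's, 'f, 'p) transsys \<Rightarrow>
    ('c, 'a, 's, 'f, 'p) uclause list" where
  "Update Sg T = concat (map (update_of Sg T) (Upd T))"

definition transition_system :: "('a, 's, 'f, 'p) signature \<Rightarrow> ('s, 'f, 'p, 'u) estruct set \<Rightarrow>
    ('c, 'a, 's, 'f, 'p) transsys \<Rightarrow> bool" where
  "transition_system Sg TE T \<longleftrightarrow>
    (let S = Param T \<union> NonParam T; TS = entails Sg TE {univ_fm (Axs T)} in
      wf_clauses Sg S (Axs T) \<and> wf_clauses Sg S (Init T) \<and>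
      distinct (Upd T) \<and>
      (\<forall>f\<in>set (Upd T). Arr f \<in> NonParam T \<and>
        (\<forall>(\<phi>, Cs)\<in>set (rules T f).
          wf_matrix Sg S {} (arity Sg f) \<phi> \<and>
          (\<forall>C\<in>set Cs. literal C \<and> wf_matrix Sg S {(rsort Sg f, 0)} (arity Sg f) C) \<and>
          TS (alls [0..<arity Sg f]
            (FDisj (Qf (Neg \<phi>)) (ExE (rsort Sg f) 0 (Qf (conj_list Cs)))))) \<and>
        (\<forall>i j. i < j \<longrightarrow> j < length (rules T f) \<longrightarrow>
          TS (alls [0..<arity Sg f]
            (Qf (Neg (Conj (fst (rules T f ! i)) (fst (rules T f ! j))))))) \<and>
        TS (alls [0..<arity Sg f] (Qf (disj_list (map fst (rules T f)))))))"

text \<open>The formula \<open>\<phi>'\<close>.\<close>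

primrec prime_leaf :: "('c, 'a) sym set \<Rightarrow> ('c, 'a, 's) eleaf \<Rightarrow> ('c, 'a, 's) eleaf" where
  "prime_leaf S (EV s n) = EV s n"
| "prime_leaf S (Rd a ts) = Rd (if Arr (base a) \<in> S then Nxt (base a) else a) ts"

definition primed :: "('c, 'a, 's, 'f, 'p) transsys \<Rightarrow>
    ('c, 'a, 's, 'f, 'p) uclause list \<Rightarrow> ('c, 'a, 's, 'f, 'p) uclause list" where
  "primed T = map (\<lambda>(k, M). (k, qsubst ILeaf (prime_leaf (NonParam T)) M))"

definition init_entails :: "('a, 's, 'f, 'p) signature \<Rightarrow> ('s, 'f, 'p, 'u) estruct set \<Rightarrow>
    ('c, 'a, 's, 'f, 'p) transsys \<Rightarrow> ('c, 'a, 's, 'f, 'p) uclause list \<Rightarrow> bool" where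
  "init_entails Sg TE T I \<longleftrightarrow> entails Sg TE {univ_fm (Axs T), univ_fm (Init T)} (univ_fm I)"

definition inductive_invariant :: "('a, 's, 'f, 'p) signature \<Rightarrow> ('s, 'f, 'p, 'u) estruct set \<Rightarrow>
    ('c, 'a, 's, 'f, 'p) transsys \<Rightarrow> ('c, 'a, 's, 'f, 'p) uclause list \<Rightarrow> bool" where
  "inductive_invariant Sg TE T I \<longleftrightarrow>
    init_entails Sg TE T I \<and>
    entails Sg TE {univ_fm (Axs T), univ_fm I, univ_fm (Update Sg T)} (univ_fm (primed T I))"


section \<open>Symbol elimination\<close>

text \<open>Skolemization of \<open>\<not> \<And>\<^sub>j \<forall>x\<^sub>0 \<dots> x\<^sub>k\<^sub>-\<^sub>1. M\<^sub>j\<close>, read as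
  \<open>\<exists>x\<^sub>0 \<dots> x\<^sub>m\<^sub>-\<^sub>1. \<Or>\<^sub>j \<not> M\<^sub>j\<close> with \<open>m\<close> the largest \<open>k\<close>.\<close>

definition num_vars :: "('c, 'a, 's, 'f, 'p) uclause list \<Rightarrow> nat" where
  "num_vars cls = Max (insert 0 (fst ` set cls))"

definition skolem_neg :: "('c, 'a, 's, 'f, 'p) uclause list \<Rightarrow> ('c, 'a, 's, 'f, 'p) xqf" where
  "skolem_neg cls = disj_list
    (map (\<lambda>(k, M). Neg (xsubst (\<lambda>l. case l of Var n \<Rightarrow> ILeaf (Sk n) | _ \<Rightarrow> ILeaf l) M)) cls)"

definition reads :: "('c, 'a, 's, 'f, 'p) xqf set \<Rightarrow> ('a psym \<times> 'c ileaf iterm list) set" where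
  "reads G = {(a, ts). \<exists>\<phi>\<in>G. Rd a ts \<in> els \<phi>}"

definition ground_reads :: "('c, 'a, 's, 'f, 'p) xqf set \<Rightarrow> ('a psym \<times> 'c ileaf iterm list) set"
  where
  "ground_reads G = {(a, ts)\<in>reads G. \<forall>t\<in>set ts. ground_over UNIV t}"

text \<open>Instances of a clause in which all terms starting with an extension symbol (a symbol in \<open>X\<close>)
  belong to a given set \<open>R\<close> of ground terms.  Variables are instantiated with arguments of
  terms in \<open>R\<close>.\<close>

definition inst_map :: "(nat \<Rightarrow> 'c ileaf iterm) \<Rightarrow> 'c ileaf \<Rightarrow> 'c ileaf iterm" where
  "inst_map \<sigma> l = (case l of Var n \<Rightarrow> \<sigma> n | _ \<Rightarrow> ILeaf l)"

definition instances :: "'a psym set \<Rightarrow> ('a psym \<times> 'c ileaf iterm list) set \<Rightarrow>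
    ('c, 'a, 's, 'f, 'p) uclause list \<Rightarrow> ('c, 'a, 's, 'f, 'p) xqf set" where
  "instances X R cls =
    {xsubst (inst_map \<sigma>) M | \<sigma> k M. (k, M) \<in> set cls \<and>
      (\<forall>n<k. \<exists>(a, ts)\<in>R. \<sigma> n \<in> set ts) \<and>
      (\<forall>(a, ts)\<in>reads {M}. a \<in> X \<longrightarrow> (a, map (isubst (inst_map \<sigma>)) ts) \<in> R)}"

text \<open>The primed symbols are defined by \<open>Update\<close> on top of the unprimed ones.  So \<open>Update\<close> is
  instantiated first, at the primed ground terms; the axioms \<open>\<K>\<close> and \<open>I\<close> are then instantiated at
  the unprimed ground terms, including those produced by the first step.\<close>

definition ground_problem :: "('a, 's, 'f, 'p) signature \<Rightarrow> ('c, 'a, 's, 'f, 'p) transsys \<Rightarrow>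
    ('c, 'a, 's, 'f, 'p) uclause list \<Rightarrow> ('c, 'a, 's, 'f, 'p) xqf set" where
  "ground_problem Sg T I =
    (let G = {skolem_neg (primed T I)};
         R1 = {(a, ts)\<in>ground_reads (G \<union> snd ` set (Update Sg T)). a \<in> range Nxt};
         U = instances (range Nxt) R1 (Update Sg T);
         R2 = {(a, ts)\<in>ground_reads (G \<union> U \<union> snd ` set (Axs T @ I)). a \<in> range Cur}
     in G \<union> U \<union> instances (range Cur) R2 (Axs T @ I))"

definition congruences :: "('a psym \<times> 'c ileaf iterm list) set \<Rightarrow> ('c, 'a, 's, 'f, 'p) xqf set" where
  "congruences R =
    {Imp (conj_list (map2 (\<lambda>t u. At (IEq t u)) ts us)) (At (EEq (ELeaf (Rd a ts)) (ELeaf (Rd a us)))) |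
      a ts us. (a, ts) \<in> R \<and> (a, us) \<in> R}"

text \<open>Constants that are not eliminated: parameters, constants standing for terms \<open>g(ts)\<close>
  with \<open>g\<close> an unprimed parameter, and index constants in the arguments of these terms.\<close>

definition kept_elements :: "('c, 'a) sym set \<Rightarrow> ('c, 'a, 's, 'f, 'p) xqf set \<Rightarrow>
    ('c, 'a, 's) eleaf set" where
  "kept_elements P G = {Rd (Cur g) ts | g ts. (Cur g, ts) \<in> reads G \<and> Arr g \<in> P}"

definition kept_indices :: "('c, 'a) sym set \<Rightarrow> ('c, 'a, 's, 'f, 'p) xqf set \<Rightarrow> 'c ileaf set" where
  "kept_indices P G = {l \<in> (\<Union>\<phi>\<in>G. ileaves \<phi>).
    (\<exists>c. l = Con c \<and> IxC c \<in> P) \<or> (\<exists>r\<in>kept_elements P G. l \<in> arg_leaves r)}"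

text \<open>A possible output of quantifier elimination in the base theory: any quantifier-free
  formula over the kept constants equivalent to the existentially quantified problem.  Here all leaves
  are free constants, in particular \<open>\<nu>\<close> need not interpret reads by functions.\<close>

definition sorted_val :: "('a, 's, 'f, 'p) signature \<Rightarrow> ('s, 'f, 'p, 'u) estruct \<Rightarrow>
    (('c, 'a, 's) eleaf \<Rightarrow> 'u) \<Rightarrow> bool" where
  "sorted_val Sg E \<nu> \<longleftrightarrow> (\<forall>l. \<nu> l \<in> carr E (leaf_sort Sg l))"

definition qe_result :: "('a, 's, 'f, 'p) signature \<Rightarrow> ('s, 'f, 'p, 'u) estruct set \<Rightarrow>
    'c ileaf set \<Rightarrow> ('c, 'a, 's) eleaf set \<Rightarrow> ('c, 'a, 's, 'f, 'p) xqf set \<Rightarrow>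
    ('c, 'a, 's, 'f, 'p) xqf \<Rightarrow> bool" where
  "qe_result Sg TE KI KE G \<theta> \<longleftrightarrow>
    wt_qf Sg (leaf_sort Sg) \<theta> \<and> ixs \<theta> \<subseteq> KI \<and> els \<theta> \<subseteq> KE \<and>
    (\<forall>E\<in>TE. \<forall>\<iota> \<nu>. sorted_val Sg E \<nu> \<longrightarrow>
      (qeval E \<iota> \<nu> \<theta> \<longleftrightarrow>
        (\<exists>\<iota>' \<nu>'. sorted_val Sg E \<nu>' \<and> (\<forall>l\<in>KI. \<iota>' l = \<iota> l) \<and> (\<forall>l\<in>KE. \<nu>' l = \<nu> l) \<and>
          (\<forall>\<phi>\<in>G. qeval E \<iota>' \<nu>' \<phi>))))"

definition symbol_elimination :: "('a, 's, 'f, 'p) signature \<Rightarrow> ('s, 'f, 'p, 'u) estruct set \<Rightarrow>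
    ('c, 'a, 's, 'f, 'p) transsys \<Rightarrow> ('c, 'a, 's, 'f, 'p) uclause list \<Rightarrow>
    ('c, 'a, 's, 'f, 'p) uclause \<Rightarrow> bool" where
  "symbol_elimination Sg TE T I \<Gamma> \<longleftrightarrow>
    (let G = ground_problem Sg T I in
      \<exists>\<theta>. qe_result Sg TE (kept_indices (Param T) G) (kept_elements (Param T) G)
            (G \<union> congruences (reads G)) \<theta> \<and>
        \<Gamma> = (num_vars I,
          Neg (xsubst (\<lambda>l. case l of Sk n \<Rightarrow> ILeaf (Var n) | _ \<Rightarrow> ILeaf l) \<theta>)))"


section \<open>The invariant strengthening algorithm\<close>

text \<open>\<open>iterate Sg TE T \<Psi> n I\<close>: some run reaches step \<open>n\<close> with \<open>I\<^sub>n = I\<close>.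
  \<open>generated Sg TE T \<Psi> n \<Gamma>\<close>: some run computes \<open>\<Gamma>\<^sub>n = \<Gamma>\<close> in step \<open>n\<close>.  Runs
  differ only in the outputs of quantifier elimination.\<close>

inductive iterate :: "('a, 's, 'f, 'p) signature \<Rightarrow> ('s, 'f, 'p, 'u) estruct set \<Rightarrow>
    ('c, 'a, 's, 'f, 'p) transsys \<Rightarrow> ('c, 'a, 's, 'f, 'p) uclause list \<Rightarrow> nat \<Rightarrow>
    ('c, 'a, 's, 'f, 'p) uclause list \<Rightarrow> bool"
  and generated :: "('a, 's, 'f, 'p) signature \<Rightarrow> ('s, 'f, 'p, 'u) estruct set \<Rightarrow>
    ('c, 'a, 's, 'f, 'p) transsys \<Rightarrow> ('c, 'a, 's, 'f, 'p) uclause list \<Rightarrow> nat \<Rightarrow>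
    ('c, 'a, 's, 'f, 'p) uclause \<Rightarrow> bool"
  for Sg TE T \<Psi> where
  start: "iterate Sg TE T \<Psi> 1 \<Psi>"
| eliminate: "iterate Sg TE T \<Psi> n I \<Longrightarrow> \<not> inductive_invariant Sg TE T I \<Longrightarrow>
    init_entails Sg TE T I \<Longrightarrow> symbol_elimination Sg TE T I \<Gamma> \<Longrightarrow> generated Sg TE T \<Psi> n \<Gamma>"
| strengthen: "iterate Sg TE T \<Psi> n I \<Longrightarrow> \<not> inductive_invariant Sg TE T I \<Longrightarrow>
    init_entails Sg TE T I \<Longrightarrow> symbol_elimination Sg TE T I \<Gamma> \<Longrightarrow>
    iterate Sg TE T \<Psi> (Suc n) (I @ [\<Gamma>])"

end

theory Submission
  imports Defs
begin

text \<open>Since all symbols in \<open>\<Sigma>\<close> are unary, every index constant is a parameter, and since there is at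
  most one universally quantified variable, the only other index leaf of the ground problem is
  \<open>Sk 0\<close>.  The array property fragment lets \<open>Sk 0\<close> occur outside of reads only in comparisons with
  parameter terms, so the truth of the ground problem depends on the position of \<open>Sk 0\<close> relative to a
  finite set \<open>W\<close> of parameter terms and not on its value.  If the output \<open>\<theta>\<close> of quantifier elimination
  mentions \<open>Sk 0\<close>, then no index constant was eliminated and \<open>\<theta>\<close> inherits this invariance, even if it
  contains divisibility atoms.  Every integer has the same position as one of the values of
  \<open>t - 1\<close>, \<open>t\<close>, \<open>t + 1\<close> for \<open>t \<in> W\<close>, or \<open>0\<close>.  So
  \<open>\<forall>x. \<not> \<theta>(x)\<close> is equivalent to the conjunction, over these representatives \<open>w\<close>, of
  \<open>\<forall>x. (x and w have the same position) \<longrightarrow> \<not> \<theta>(w)\<close>, where \<open>w\<close> replaces \<open>x\<close> in index atoms only.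
  The invariance is semantic, so the iterates may contain \<open>\<Gamma>\<^sub>n\<close> as it was computed, before it is
  rewritten.\<close>

section \<open>Substitution\<close>

lemma set_isubst [simp]: "set_iterm (isubst \<sigma> t) = (\<Union>l\<in>set_iterm t. set_iterm (\<sigma> l))"
  by (induction t) auto

lemma ieval_isubst [simp]: "ieval \<iota> (isubst \<sigma> t) = ieval (\<lambda>l. ieval \<iota> (\<sigma> l)) t"
  by (induction t) auto

lemma ieval_cong: "(\<And>l. l \<in> set_iterm t \<Longrightarrow> \<iota> l = \<iota>' l) \<Longrightarrow> ieval \<iota> t = ieval \<iota>' t"
  by (induction t) auto

lemma isubst_cong: "(\<And>l. l \<in> set_iterm t \<Longrightarrow> \<sigma> l = \<sigma>' l) \<Longrightarrow> isubst \<sigma> t = isubst \<sigma>' t"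
  by (induction t) auto

lemma isubst_isubst [simp]: "isubst \<sigma> (isubst \<sigma>' t) = isubst (\<lambda>l. isubst \<sigma> (\<sigma>' l)) t"
  by (induction t) auto

lemma isubst_ILeaf [simp]: "isubst ILeaf t = t"
  by (induction t) auto

lemma isubst_id_on: "(\<And>l. l \<in> set_iterm t \<Longrightarrow> \<sigma> l = ILeaf l) \<Longrightarrow> isubst \<sigma> t = t"
  using isubst_cong[of t \<sigma> ILeaf] by simp

lemma finite_set1_eterm [simp]: "finite (set1_eterm t)"
  by (induction t) auto

lemma finite_els [simp]: "finite (els \<phi>)"
proof (induction \<phi>)
  case (At a)
  then show ?case by (cases a) auto
qed auto

lemma eeval_map_eterm [simp]: "eeval E \<nu> (map_eterm \<tau> id t) = eeval E (\<lambda>l. \<nu> (\<tau> l)) t"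
proof (induction t)
  case (EFn f ts)
  have "map (eeval E \<nu> \<circ> map_eterm \<tau> id) ts = map (eeval E (\<lambda>l. \<nu> (\<tau> l))) ts"
    by (rule map_cong[OF refl]) (simp only: comp_apply EFn.IH)
  then show ?case by (simp only: eterm.map eeval.simps map_map id_def)
qed simp

lemma eeval_cong: "(\<And>l. l \<in> set1_eterm t \<Longrightarrow> \<nu> l = \<nu>' l) \<Longrightarrow> eeval E \<nu> t = eeval E \<nu>' t"
proof (induction t)
  case (EFn f ts)
  then have "map (eeval E \<nu>) ts = map (eeval E \<nu>') ts" by (intro map_cong) auto
  then show ?case by (simp only: eeval.simps)
qed simp

lemma set1_asubst [simp]: "set1_atom (asubst \<sigma> \<tau> a) = (\<Union>l\<in>set1_atom a. set_iterm (\<sigma> l))"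
  by (cases a) auto

lemma set2_asubst [simp]: "set2_atom (asubst \<sigma> \<tau> a) = \<tau> ` set2_atom a"
  by (cases a) (auto simp: eterm.set_map)

lemma ixs_qsubst [simp]: "ixs (qsubst \<sigma> \<tau> \<phi>) = (\<Union>l\<in>ixs \<phi>. set_iterm (\<sigma> l))"
  by (induction \<phi>) auto

lemma els_qsubst [simp]: "els (qsubst \<sigma> \<tau> \<phi>) = \<tau> ` els \<phi>"
  by (induction \<phi>) auto

lemma aeval_asubst [simp]:
  "aeval E \<iota> \<nu> (asubst \<sigma> \<tau> a) = aeval E (\<lambda>l. ieval \<iota> (\<sigma> l)) (\<lambda>l. \<nu> (\<tau> l)) a"
  by (cases a) (simp_all add: comp_def)

text \<open>Index leaves are replaced by terms but element leaves only by leaves, so a substitution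
  acts on the two valuations separately.\<close>

lemma qeval_qsubst [simp]:
  "qeval E \<iota> \<nu> (qsubst \<sigma> \<tau> \<phi>) = qeval E (\<lambda>l. ieval \<iota> (\<sigma> l)) (\<lambda>l. \<nu> (\<tau> l)) \<phi>"
  by (induction \<phi>) auto

lemma aeval_cong:
  assumes "\<And>l. l \<in> set1_atom a \<Longrightarrow> \<iota> l = \<iota>' l" "\<And>l. l \<in> set2_atom a \<Longrightarrow> \<nu> l = \<nu>' l"
  shows "aeval E \<iota> \<nu> a = aeval E \<iota>' \<nu>' a"
proof (cases a)
  case (EPr p ts)
  then have "map (eeval E \<nu>) ts = map (eeval E \<nu>') ts"
    using assms(2) by (auto intro!: eeval_cong)
  then show ?thesis using EPr by (simp only: aeval.simps)
qed (use assms in \<open>simp_all add: ieval_cong[of _ \<iota> \<iota>'] eeval_cong[of _ \<nu> \<nu>']\<close>)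

lemma qeval_cong:
  assumes "\<And>l. l \<in> ixs \<phi> \<Longrightarrow> \<iota> l = \<iota>' l" "\<And>l. l \<in> els \<phi> \<Longrightarrow> \<nu> l = \<nu>' l"
  shows "qeval E \<iota> \<nu> \<phi> = qeval E \<iota>' \<nu>' \<phi>"
  using assms
proof (induction \<phi>)
  case (At a)
  then show ?case using aeval_cong[of a \<iota> \<iota>' \<nu> \<nu>' E] by simp
qed auto

lemma asubst_cong:
  assumes "\<And>l. l \<in> set1_atom a \<Longrightarrow> \<sigma> l = \<sigma>' l" "\<And>l. l \<in> set2_atom a \<Longrightarrow> \<tau> l = \<tau>' l"
  shows "asubst \<sigma> \<tau> a = asubst \<sigma>' \<tau>' a"
  using assms by (cases a) (auto intro: isubst_cong intro!: eterm.map_cong)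

lemma qsubst_cong:
  assumes "\<And>l. l \<in> ixs \<phi> \<Longrightarrow> \<sigma> l = \<sigma>' l" "\<And>l. l \<in> els \<phi> \<Longrightarrow> \<tau> l = \<tau>' l"
  shows "qsubst \<sigma> \<tau> \<phi> = qsubst \<sigma>' \<tau>' \<phi>"
  using assms
proof (induction \<phi>)
  case (At a)
  then show ?case by (auto intro: asubst_cong)
qed auto

lemma asubst_asubst [simp]:
  "asubst \<sigma> \<tau> (asubst \<sigma>' \<tau>' a) = asubst (\<lambda>l. isubst \<sigma> (\<sigma>' l)) (\<lambda>l. \<tau> (\<tau>' l)) a"
  by (cases a) (auto simp: eterm.map_comp comp_def id_def)

lemma qsubst_qsubst [simp]:
  "qsubst \<sigma> \<tau> (qsubst \<sigma>' \<tau>' \<phi>) = qsubst (\<lambda>l. isubst \<sigma> (\<sigma>' l)) (\<lambda>l. \<tau> (\<tau>' l)) \<phi>"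
  by (induction \<phi>) auto

lemma lsubst_lsubst [simp]: "lsubst \<sigma> (lsubst \<sigma>' l) = lsubst (\<lambda>l. isubst \<sigma> (\<sigma>' l)) l"
  by (cases l) auto

lemma xsubst_xsubst: "xsubst \<sigma> (xsubst \<sigma>' \<phi>) = xsubst (\<lambda>l. isubst \<sigma> (\<sigma>' l)) \<phi>"
  by (simp add: xsubst_def)

text \<open>Reads carry index terms as arguments, so agreement is required on \<open>ileaves\<close>
  and not only on the leaves of index atoms.\<close>

lemma xsubst_cong:
  assumes "\<And>l. l \<in> ileaves \<phi> \<Longrightarrow> \<sigma> l = \<sigma>' l"
  shows "xsubst \<sigma> \<phi> = xsubst \<sigma>' \<phi>"
  unfolding xsubst_def
proof (rule qsubst_cong)
  fix l assume "l \<in> els \<phi>"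
  then have "arg_leaves l \<subseteq> ileaves \<phi>" by (auto simp: ileaves_def)
  with assms show "lsubst \<sigma> l = lsubst \<sigma>' l"
    by (cases l) (auto intro!: isubst_cong)
qed (use assms in \<open>simp add: ileaves_def\<close>)

section \<open>Preservation of sorts under substitution\<close>

lemma leaf_sort_lsubst [simp]: "leaf_sort Sg (lsubst \<sigma> l) = leaf_sort Sg l"
  by (cases l) auto

lemma leaf_sort_prime_leaf [simp]: "leaf_sort Sg (prime_leaf S l) = leaf_sort Sg l"
  by (cases l) auto

lemma esort_map_eterm [simp]: "esort Sg ls (map_eterm \<tau> id t) = esort Sg (\<lambda>l. ls (\<tau> l)) t"
proof (induction t)
  case (EFn f ts)
  have "map (esort Sg ls \<circ> map_eterm \<tau> id) ts = map (esort Sg (\<lambda>l. ls (\<tau> l))) ts"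
    by (rule map_cong[OF refl]) (simp only: comp_apply EFn.IH)
  then show ?case by (simp only: eterm.map esort.simps map_map id_def)
qed simp

lemma wt_atom_asubst [simp]: "wt_atom Sg ls (asubst \<sigma> \<tau> a) = wt_atom Sg (\<lambda>l. ls (\<tau> l)) a"
  by (cases a) (simp_all add: comp_def)

lemma wt_qf_qsubst [simp]: "wt_qf Sg ls (qsubst \<sigma> \<tau> \<phi>) = wt_qf Sg (\<lambda>l. ls (\<tau> l)) \<phi>"
  by (induction \<phi>) auto

lemma wt_qf_xsubst [simp]: "wt_qf Sg (leaf_sort Sg) (xsubst \<sigma> \<phi>) = wt_qf Sg (leaf_sort Sg) \<phi>"
  by (simp add: xsubst_def)

section \<open>Order invariance\<close>

definition param_leaves :: "('c, 'a) sym set \<Rightarrow> 'c ileaf set" where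
  "param_leaves P = {Con c | c. IxC c \<in> P}"

definition param_term :: "('c, 'a) sym set \<Rightarrow> 'c ileaf iterm \<Rightarrow> bool" where
  "param_term P t \<longleftrightarrow> set_iterm t \<subseteq> param_leaves P"

text \<open>The shapes of index terms that Skolemization and instantiation leave in guards and read
  arguments: a Skolem constant on its own, never under arithmetic, or a term over
  parameters.\<close>

definition simple_term :: "('c, 'a) sym set \<Rightarrow> nat \<Rightarrow> 'c ileaf iterm \<Rightarrow> bool" where
  "simple_term P m t \<longleftrightarrow> (\<exists>n<m. t = ILeaf (Sk n)) \<or> param_term P t"

text \<open>The two equivalences leave three possible positions: below, equal to, or above
  \<open>d\<close>.\<close>

definition same_side :: "int \<Rightarrow> int \<Rightarrow> int \<Rightarrow> bool" where
  "same_side d z z' \<longleftrightarrow> (z \<le> d \<longleftrightarrow> z' \<le> d) \<and> (d \<le> z \<longleftrightarrow> d \<le> z')"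

text \<open>\<open>\<nu>\<close> interprets the reads as free constants, so this is a property of the index atoms.\<close>

definition order_invariant :: "('a, 's, 'f, 'p) signature \<Rightarrow> ('s, 'f, 'p, 'u) estruct set \<Rightarrow>
    'c ileaf \<Rightarrow> 'c ileaf iterm set \<Rightarrow> ('c, 'a, 's, 'f, 'p) xqf \<Rightarrow> bool" where
  "order_invariant Sg TE x W \<phi> \<longleftrightarrow> (\<forall>E\<in>TE. \<forall>\<iota> \<nu> z z'. sorted_val Sg E \<nu> \<longrightarrow>
    (\<forall>t\<in>W. same_side (ieval \<iota> t) z z') \<longrightarrow>
    qeval E (\<iota>(x := z)) \<nu> \<phi> = qeval E (\<iota>(x := z')) \<nu> \<phi>)"

definition simple_reads :: "('a, 's, 'f, 'p) signature \<Rightarrow> ('c, 'a) sym set \<Rightarrow> nat \<Rightarrow>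
    ('c, 'a, 's, 'f, 'p) xqf \<Rightarrow> bool" where
  "simple_reads Sg P m \<phi> \<longleftrightarrow> (\<forall>a ts. Rd a ts \<in> els \<phi> \<longrightarrow>
    length ts = arity Sg (base a) \<and> (\<forall>t\<in>set ts. simple_term P m t))"

text \<open>Invariance is required semantically, relative to some finite set of parameter terms.
  Quantifier elimination may return any equivalent formula, also one with divisibility atoms, so a
  syntactic restriction on index atoms would be lost.\<close>

definition simple_qf :: "('a, 's, 'f, 'p) signature \<Rightarrow> ('s, 'f, 'p, 'u) estruct set \<Rightarrow>
    ('c, 'a) sym set \<Rightarrow> nat \<Rightarrow> ('c, 'a, 's, 'f, 'p) xqf \<Rightarrow> bool" where
  "simple_qf Sg TE P m \<phi> \<longleftrightarrow> ixs \<phi> \<subseteq> param_leaves P \<union> Sk ` {..<m} \<and> simple_reads Sg P m \<phi> \<and>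
    (\<exists>W. finite W \<and> (\<forall>t\<in>W. param_term P t) \<and> order_invariant Sg TE (Sk 0) W \<phi>)"

text \<open>Skolemization and instantiation at read arguments are both instances by simple terms.
  Quantifying over all such instances makes this class of clauses stable under what the algorithm
  does to an iterate.\<close>

definition simple_clause :: "('a, 's, 'f, 'p) signature \<Rightarrow> ('s, 'f, 'p, 'u) estruct set \<Rightarrow>
    ('c, 'a) sym set \<Rightarrow> ('c, 'a, 's, 'f, 'p) uclause \<Rightarrow> bool" where
  "simple_clause Sg TE P = (\<lambda>(k, M). ileaves M \<subseteq> param_leaves P \<union> Var ` {..<k} \<and>
    (\<forall>\<sigma> m. m \<le> 1 \<longrightarrow> (\<forall>n<k. simple_term P m (\<sigma> n)) \<longrightarrow>
      simple_qf Sg TE P m (xsubst (inst_map \<sigma>) M)))"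

lemma param_leaves_simps [simp]:
  "Var n \<notin> param_leaves P" "Sk n \<notin> param_leaves P" "Con c \<in> param_leaves P \<longleftrightarrow> IxC c \<in> P"
  by (auto simp: param_leaves_def)

lemma inst_map_param_leaf [simp]: "l \<in> param_leaves P \<Longrightarrow> inst_map \<sigma> l = ILeaf l"
  by (auto simp: param_leaves_def inst_map_def)

lemma inst_map_simps [simp]:
  "inst_map \<sigma> (Var n) = \<sigma> n" "inst_map \<sigma> (Con c) = ILeaf (Con c)" "inst_map \<sigma> (Sk n) = ILeaf (Sk n)"
  by (simp_all add: inst_map_def)

lemma simple_term_leaves:
  "simple_term P m t \<Longrightarrow> set_iterm t \<subseteq> param_leaves P \<union> Sk ` {..<m}"
  by (auto simp: simple_term_def param_term_def)

lemma param_term_isubst [simp]: "param_term P t \<Longrightarrow> isubst (inst_map \<sigma>) t = t"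
  by (rule isubst_id_on) (auto simp: param_term_def)

lemma order_invariantD:
  assumes "order_invariant Sg TE x W \<phi>" "E \<in> TE" "sorted_val Sg E \<nu>"
    and "\<forall>t\<in>W. same_side (ieval \<iota> t) z z'"
  shows "qeval E (\<iota>(x := z)) \<nu> \<phi> = qeval E (\<iota>(x := z')) \<nu> \<phi>"
  using assms unfolding order_invariant_def by blast

lemma order_invariant_mono:
  "order_invariant Sg TE x W \<phi> \<Longrightarrow> W \<subseteq> W' \<Longrightarrow> order_invariant Sg TE x W' \<phi>"
  unfolding order_invariant_def by blast

lemma order_invariant_not_in: "x \<notin> ixs \<phi> \<Longrightarrow> order_invariant Sg TE x W \<phi>"
  unfolding order_invariant_def by (intro ballI allI impI qeval_cong) auto

lemma order_invariant_Imp: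
  "order_invariant Sg TE x W \<phi> \<Longrightarrow> order_invariant Sg TE x W \<psi> \<Longrightarrow>
    order_invariant Sg TE x W (Imp \<phi> \<psi>)"
  unfolding order_invariant_def qeval.simps by blast

lemma simple_readsD:
  "simple_reads Sg P m \<phi> \<Longrightarrow> Rd a ts \<in> els \<phi> \<Longrightarrow>
    length ts = arity Sg (base a) \<and> (\<forall>t\<in>set ts. simple_term P m t)"
  unfolding simple_reads_def by blast

lemma simple_qf_reads: "simple_qf Sg TE P m \<phi> \<Longrightarrow> simple_reads Sg P m \<phi>"
  by (simp add: simple_qf_def)

lemma simple_qf_ileaves:
  assumes "simple_qf Sg TE P m \<phi>"
  shows "ileaves \<phi> \<subseteq> param_leaves P \<union> Sk ` {..<m}"
proof
  fix l assume l: "l \<in> ileaves \<phi>"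
  show "l \<in> param_leaves P \<union> Sk ` {..<m}"
  proof (cases "l \<in> ixs \<phi>")
    case False
    then obtain r where r: "r \<in> els \<phi>" "l \<in> arg_leaves r"
      using l by (auto simp: ileaves_def)
    then obtain a ts t where "r = Rd a ts" "t \<in> set ts" "l \<in> set_iterm t"
      by (cases r rule: eleaf.exhaust) auto
    moreover from this have "simple_term P m t"
      using simple_readsD[OF simple_qf_reads[OF assms], of a ts] r by simp
    ultimately show ?thesis using simple_term_leaves by fast
  qed (use assms in \<open>auto simp: simple_qf_def\<close>)
qed

section \<open>Index guards after instantiation\<close>

fun simple_guard :: "('c, 'a) sym set \<Rightarrow> nat \<Rightarrow> ('c, 'a, 's, 'f, 'p) xqf \<Rightarrow> bool" where
  "simple_guard P m Tru = True"
| "simple_guard P m (At (ILe t u)) = (simple_term P m t \<and> simple_term P m u)"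
| "simple_guard P m (At (IEq t u)) = (simple_term P m t \<and> simple_term P m u)"
| "simple_guard P m (Conj \<phi> \<psi>) = (simple_guard P m \<phi> \<and> simple_guard P m \<psi>)"
| "simple_guard P m (Disj \<phi> \<psi>) = (simple_guard P m \<phi> \<and> simple_guard P m \<psi>)"
| "simple_guard P m _ = False"

text \<open>Those of the compared terms that are over parameters form the set relative to which a
  guard is order invariant.\<close>

fun guard_terms :: "('c, 'a, 's, 'f, 'p) xqf \<Rightarrow> 'c ileaf iterm set" where
  "guard_terms (At (ILe t u)) = {t, u}"
| "guard_terms (At (IEq t u)) = {t, u}"
| "guard_terms (Conj \<phi> \<psi>) = guard_terms \<phi> \<union> guard_terms \<psi>"
| "guard_terms (Disj \<phi> \<psi>) = guard_terms \<phi> \<union> guard_terms \<psi>"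
| "guard_terms _ = {}"

lemma finite_guard_terms [simp]: "finite (guard_terms \<phi>)"
  by (induction \<phi> rule: guard_terms.induct) auto

lemma simple_guard_ixs: "simple_guard P m \<phi> \<Longrightarrow> ixs \<phi> \<subseteq> param_leaves P \<union> Sk ` {..<m}"
  by (induction P m \<phi> rule: simple_guard.induct) (auto dest!: simple_term_leaves)

lemma simple_guard_els: "simple_guard P m \<phi> \<Longrightarrow> els \<phi> = {}"
  by (induction P m \<phi> rule: simple_guard.induct) auto

lemma ieval_param_upd: "param_term P t \<Longrightarrow> ieval (\<iota>(Sk n := z)) t = ieval \<iota> t"
  by (auto simp: param_term_def intro!: ieval_cong)

text \<open>As \<open>m \<le> 1\<close>, each side is \<open>Sk 0\<close> or does not depend on it.
  Two parameter terms keep their values, two copies of \<open>Sk 0\<close> stay equal, and a mixed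
  comparison is one of the two equivalences in \<open>same_side\<close>.\<close>

lemma simple_term_compare:
  assumes "simple_term P m t" "simple_term P m u" "m \<le> 1"
    and "param_term P t \<Longrightarrow> same_side (ieval \<iota> t) z z'"
    and "param_term P u \<Longrightarrow> same_side (ieval \<iota> u) z z'"
  shows "ieval (\<iota>(Sk 0 := z)) t \<le> ieval (\<iota>(Sk 0 := z)) u \<longleftrightarrow>
    ieval (\<iota>(Sk 0 := z')) t \<le> ieval (\<iota>(Sk 0 := z')) u"
proof -
  have "v = ILeaf (Sk 0) \<or> param_term P v" if "simple_term P m v" for v
    using that \<open>m \<le> 1\<close> by (auto simp: simple_term_def)
  then consider "t = ILeaf (Sk 0)" "u = ILeaf (Sk 0)" | "t = ILeaf (Sk 0)" "param_term P u"
    | "param_term P t" "u = ILeaf (Sk 0)" | "param_term P t" "param_term P u"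
    using assms(1,2) by blast
  then show ?thesis
  proof cases
    case 2
    then show ?thesis using assms(5) by (simp add: ieval_param_upd same_side_def)
  next
    case 3
    then show ?thesis using assms(4) by (simp add: ieval_param_upd same_side_def)
  qed (simp_all add: ieval_param_upd)
qed

lemma simple_guard_qeval:
  assumes "simple_guard P m \<phi>" "m \<le> 1"
    and "\<forall>t\<in>guard_terms \<phi>. param_term P t \<longrightarrow> same_side (ieval \<iota> t) z z'"
  shows "qeval E (\<iota>(Sk 0 := z)) \<nu> \<phi> = qeval E (\<iota>(Sk 0 := z')) \<nu> \<phi>"
  using assms
proof (induction P m \<phi> rule: simple_guard.induct)
  case (2 P m t u)
  then show ?case
    using simple_term_compare[of P m t u \<iota> z z'] by (simp del: fun_upd_apply)
next
  \<comment> \<open>An equation is the conjunction of the two opposite inequalities.\<close>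
  case (3 P m t u)
  then show ?case
    using simple_term_compare[of P m t u \<iota> z z'] simple_term_compare[of P m u t \<iota> z z']
    by (simp add: order_eq_iff del: fun_upd_apply)
qed auto

lemma simple_guard_order_invariant:
  assumes "simple_guard P m \<phi>" "m \<le> 1"
  shows "order_invariant Sg TE (Sk 0) {t \<in> guard_terms \<phi>. param_term P t} \<phi>"
  unfolding order_invariant_def using simple_guard_qeval[OF assms] by blast

text \<open>The guard supplies the separating terms. In the conclusion \<open>Sk 0\<close> can occur
  only inside reads, which are free constants for \<open>order_invariant\<close>. Instances of array
  properties and congruence axioms both have this form.\<close>

lemma simple_qf_guard_Imp:
  assumes \<phi>: "simple_guard P m \<phi>" and "m \<le> 1"
    and \<psi>: "ixs \<psi> \<subseteq> param_leaves P" "simple_reads Sg P m \<psi>"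
  shows "simple_qf Sg TE P m (Imp \<phi> \<psi>)"
proof -
  let ?W = "{t \<in> guard_terms \<phi>. param_term P t}"
  have "Sk 0 \<notin> ixs \<psi>" using \<psi>(1) by auto
  then have "order_invariant Sg TE (Sk 0) ?W (Imp \<phi> \<psi>)"
    by (intro order_invariant_Imp simple_guard_order_invariant[OF \<phi> \<open>m \<le> 1\<close>]
        order_invariant_not_in)
  moreover have "simple_reads Sg P m (Imp \<phi> \<psi>)"
    using \<psi>(2) simple_guard_els[OF \<phi>] by (auto simp: simple_reads_def)
  ultimately show ?thesis
    using \<psi>(1) simple_guard_ixs[OF \<phi>] unfolding simple_qf_def
    by (auto intro!: exI[of _ ?W])
qed

lemma simple_qf_param:
  assumes "ixs \<phi> \<subseteq> param_leaves P" "simple_reads Sg P m \<phi>"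
  shows "simple_qf Sg TE P m \<phi>"
proof -
  have "order_invariant Sg TE (Sk 0) {} \<phi>"
    using assms(1) by (intro order_invariant_not_in) auto
  then show ?thesis using assms unfolding simple_qf_def by blast
qed

section \<open>Priming\<close>

lemma simple_qf_prime:
  fixes \<phi> :: "('c, 'a, 's, 'f, 'p) xqf" and TE :: "('s, 'f, 'p, 'u) estruct set"
  assumes "simple_qf Sg TE P m \<phi>"
  shows "simple_qf Sg TE P m (qsubst ILeaf (prime_leaf S) \<phi>)"
proof -
  have "simple_reads Sg P m (qsubst ILeaf (prime_leaf S) \<phi>)"
    unfolding simple_reads_def
  proof (intro allI impI)
    fix a ts assume "Rd a ts \<in> els (qsubst ILeaf (prime_leaf S) \<phi>)"
    then obtain r where r: "r \<in> els \<phi>" "Rd a ts = prime_leaf S r" by auto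
    then obtain b where "r = Rd b ts" "base b = base a"
      by (cases r rule: eleaf.exhaust) auto
    with r assms show "length ts = arity Sg (base a) \<and> (\<forall>t\<in>set ts. simple_term P m t)"
      using simple_readsD[OF simple_qf_reads[OF assms], of b ts] by auto
  qed
  moreover have "order_invariant Sg TE (Sk 0) W (qsubst ILeaf (prime_leaf S) \<phi>)"
    if W: "order_invariant Sg TE (Sk 0) W \<phi>" for W
    unfolding order_invariant_def
  proof (intro ballI allI impI)
    fix E \<iota> z z' and \<nu> :: "('c, 'a, 's) eleaf \<Rightarrow> 'u"
    assume "E \<in> TE" "sorted_val Sg E \<nu>" and W': "\<forall>t\<in>W. same_side (ieval \<iota> t) z z'"
    \<comment> \<open>Priming renames element leaves and keeps their sorts, so its effect is
      absorbed by composing the valuation with \<open>prime_leaf\<close>.\<close>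
    have "sorted_val Sg E (\<lambda>l. \<nu> (prime_leaf S l))"
      using \<open>sorted_val Sg E \<nu>\<close> unfolding sorted_val_def
      by (metis leaf_sort_prime_leaf)
    from order_invariantD[OF W \<open>E \<in> TE\<close> this W']
    show "qeval E (\<iota>(Sk 0 := z)) \<nu> (qsubst ILeaf (prime_leaf S) \<phi>) =
        qeval E (\<iota>(Sk 0 := z')) \<nu> (qsubst ILeaf (prime_leaf S) \<phi>)"
      by (simp del: fun_upd_apply)
  qed
  ultimately show ?thesis
    using assms unfolding simple_qf_def by auto
qed

lemma lsubst_prime_leaf: "lsubst \<sigma> (prime_leaf S l) = prime_leaf S (lsubst \<sigma> l)"
  by (cases l) auto

lemma arg_leaves_prime_leaf [simp]: "arg_leaves (prime_leaf S l) = arg_leaves l"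
  by (cases l) auto

text \<open>Instantiation changes the arguments of reads and priming changes their symbols, so the
  two commute.\<close>

lemma simple_clause_prime:
  fixes M :: "('c, 'a, 's, 'f, 'p) xqf"
  assumes "simple_clause Sg TE P (k, M)"
  shows "simple_clause Sg TE P (k, qsubst ILeaf (prime_leaf S) M)"
proof -
  have "xsubst (inst_map \<sigma>) (qsubst ILeaf (prime_leaf S) M) =
      qsubst ILeaf (prime_leaf S) (xsubst (inst_map \<sigma>) M)" for \<sigma> :: "nat \<Rightarrow> 'c ileaf iterm"
    by (simp add: xsubst_def lsubst_prime_leaf)
  moreover have "ileaves (qsubst ILeaf (prime_leaf S) M) = ileaves M"
    by (auto simp: ileaves_def)
  ultimately show ?thesis
    using assms by (auto simp: simple_clause_def simple_qf_prime)
qed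

section \<open>Instantiation of clauses of the array property fragment\<close>

lemma ground_over_param_term:
  assumes "ground_over {..<k} t" "set_iterm t \<subseteq> param_leaves P \<union> Var ` {..<k}"
  shows "param_term P t"
  using assms by (auto simp: ground_over_def param_term_def)

text \<open>A bare variable becomes the term chosen for it; a ground term has only parameter leaves
  and is left unchanged.\<close>

lemma var_or_ground_inst:
  assumes "var_or_ground {..<k} t" "set_iterm t \<subseteq> param_leaves P \<union> Var ` {..<k}"
    and "\<forall>n<k. simple_term P m (\<sigma> n)"
  shows "simple_term P m (isubst (inst_map \<sigma>) t)"
proof (cases "\<exists>v\<in>{..<k}. t = ILeaf (Var v)")
  case False
  then have "param_term P t"
    using assms(1,2) ground_over_param_term by (auto simp: var_or_ground_def)
  then show ?thesis by (simp add: simple_term_def)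
qed (use assms(3) in auto)

lemma ixs_inst_param:
  "ixs M \<subseteq> param_leaves P \<Longrightarrow> ixs (xsubst (inst_map \<sigma>) M) \<subseteq> param_leaves P"
  unfolding xsubst_def ixs_qsubst by (intro UN_least) (auto dest!: subsetD)

lemma index_guard_inst:
  assumes "index_guard {..<k} \<phi>" "ixs \<phi> \<subseteq> param_leaves P \<union> Var ` {..<k}"
    and "\<forall>n<k. simple_term P m (\<sigma> n)"
  shows "simple_guard P m (xsubst (inst_map \<sigma>) \<phi>)"
  using assms
  by (induction "{..<k}" \<phi> rule: index_guard.induct) (auto simp: xsubst_def var_or_ground_inst)

text \<open>The condition on reads shared by value constraints and ground matrices; for the latter
  its second part is trivial.\<close>

definition reads_ok :: "('a, 's, 'f, 'p) signature \<Rightarrow> nat \<Rightarrow> ('c, 'a, 's, 'f, 'p) xqf \<Rightarrow> bool" where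
  "reads_ok Sg k M \<longleftrightarrow> (\<forall>a ts. Rd a ts \<in> els M \<longrightarrow> length ts = arity Sg (base a) \<and>
    (\<forall>t\<in>set ts. var_or_ground {..<k} t))"

lemma reads_ok_inst:
  assumes "reads_ok Sg k M" "ileaves M \<subseteq> param_leaves P \<union> Var ` {..<k}"
    and "\<forall>n<k. simple_term P m (\<sigma> n)"
  shows "simple_reads Sg P m (xsubst (inst_map \<sigma>) M)"
  unfolding simple_reads_def
proof (intro allI impI)
  fix a ts assume "Rd a ts \<in> els (xsubst (inst_map \<sigma>) M)"
  then obtain r where r: "r \<in> els M" "Rd a ts = lsubst (inst_map \<sigma>) r" by (auto simp: xsubst_def)
  then obtain us where us: "r = Rd a us" "ts = map (isubst (inst_map \<sigma>)) us"
    by (cases r rule: eleaf.exhaust) auto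
  have "simple_term P m (isubst (inst_map \<sigma>) u)" if u: "u \<in> set us" for u
  proof (rule var_or_ground_inst)
    show "var_or_ground {..<k} u" using assms(1) r us u by (auto simp: reads_ok_def)
    have "set_iterm u \<subseteq> arg_leaves r" using us u by auto
    also have "\<dots> \<subseteq> ileaves M" using r(1) by (auto simp: ileaves_def)
    finally show "set_iterm u \<subseteq> param_leaves P \<union> Var ` {..<k}" using assms(2) by blast
  qed (rule assms(3))
  moreover have "length us = arity Sg (base a)"
    using assms(1) r us by (auto simp: reads_ok_def)
  ultimately show "length ts = arity Sg (base a) \<and> (\<forall>t\<in>set ts. simple_term P m t)"
    using us by auto
qed

text \<open>With variables present, the matrix has the guard form and
  \<open>simple_qf_guard_Imp\<close> applies to each instance. Without variables the fragment
  imposes no form, but then all index atoms are over parameters.\<close>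

lemma simple_clause_apf:
  assumes leaves: "ileaves M \<subseteq> param_leaves P \<union> Var ` {..<k}"
    and len: "\<And>a ts. Rd a ts \<in> els M \<Longrightarrow> length ts = arity Sg (base a)"
    and apf: "k = 0 \<or> (\<exists>\<phi> \<psi>. M = Imp \<phi> \<psi> \<and> index_guard {..<k} \<phi> \<and> value_constraint {..<k} \<psi>)"
  shows "simple_clause Sg TE P (k, M)"
  unfolding simple_clause_def split_conv
proof (intro conjI leaves allI impI)
  fix \<sigma> m assume m: "(m::nat) \<le> 1" and \<sigma>: "\<forall>n<k. simple_term P m (\<sigma> n)"
  show "simple_qf Sg TE P m (xsubst (inst_map \<sigma>) M)"
  proof (cases "k = 0")
    case True
    then have ixs: "ixs (xsubst (inst_map \<sigma>) M) \<subseteq> param_leaves P"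
      using leaves by (intro ixs_inst_param) (auto simp: ileaves_def)
    have "reads_ok Sg k M"
      using len True by (auto simp: reads_ok_def var_or_ground_def ground_over_def)
    then show ?thesis using ixs reads_ok_inst[OF _ leaves \<sigma>] by (intro simple_qf_param)
  next
    case False
    then obtain \<phi> \<psi> where M: "M = Imp \<phi> \<psi>" "index_guard {..<k} \<phi>" "value_constraint {..<k} \<psi>"
      using apf by blast
    have "ixs \<psi> \<subseteq> param_leaves P" and l: "ixs \<phi> \<subseteq> param_leaves P \<union> Var ` {..<k}"
      "ileaves \<psi> \<subseteq> param_leaves P \<union> Var ` {..<k}"
      using leaves M by (auto simp: ileaves_def value_constraint_def)
    from this(1) have ixs: "ixs (xsubst (inst_map \<sigma>) \<psi>) \<subseteq> param_leaves P"
      by (rule ixs_inst_param)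
    have "reads_ok Sg k \<psi>"
      using M len by (auto simp: reads_ok_def value_constraint_def)
    then have "simple_reads Sg P m (xsubst (inst_map \<sigma>) \<psi>)"
      using reads_ok_inst l(2) \<sigma> by blast
    then show ?thesis
      using simple_qf_guard_Imp[OF index_guard_inst[OF M(2) l(1) \<sigma>] m ixs] M(1)
      by (simp add: xsubst_def)
  qed
qed

section \<open>The ground problem\<close>

text \<open>\<open>Rd\<close> is injective, so the reads in one formula form the preimage of a
  finite set.\<close>

lemma finite_reads:
  fixes G :: "('c, 'a, 's, 'f, 'p) xqf set"
  assumes "finite G"
  shows "finite (reads G)"
proof -
  have "reads G = (\<Union>\<phi>\<in>G. (\<lambda>(a, ts). Rd a ts) -` els \<phi>)"
    by (auto simp: reads_def)
  moreover have "finite ((\<lambda>(a, ts). Rd a ts) -` els \<phi>)" for \<phi> :: "('c, 'a, 's, 'f, 'p) xqf"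
    by (intro finite_vimageI finite_els) (auto intro!: injI)
  ultimately show ?thesis using assms by simp
qed

definition simple_args :: "('c, 'a) sym set \<Rightarrow> nat \<Rightarrow> ('a psym \<times> 'c ileaf iterm list) set \<Rightarrow> bool"
  where "simple_args P m R \<longleftrightarrow> (\<forall>(a, ts)\<in>R. \<forall>t\<in>set ts. simple_term P m t)"

lemma simple_clause_leaves:
  "simple_clause Sg TE P (k, M) \<Longrightarrow> ileaves M \<subseteq> param_leaves P \<union> Var ` {..<k}"
  by (simp add: simple_clause_def)

lemma simple_clauseD:
  "simple_clause Sg TE P (k, M) \<Longrightarrow> m \<le> 1 \<Longrightarrow> (\<And>n. n < k \<Longrightarrow> simple_term P m (\<sigma> n)) \<Longrightarrow>
    simple_qf Sg TE P m (xsubst (inst_map \<sigma>) M)"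
  by (simp add: simple_clause_def)

lemma instances_simple:
  assumes "\<forall>cl\<in>set cls. simple_clause Sg TE P cl" "simple_args P m R" "m \<le> 1"
    and "\<phi> \<in> instances X R cls"
  shows "simple_qf Sg TE P m \<phi>"
proof -
  obtain \<sigma> k M where *: "\<phi> = xsubst (inst_map \<sigma>) M" "(k, M) \<in> set cls"
    "\<forall>n<k. \<exists>(a, ts)\<in>R. \<sigma> n \<in> set ts"
    using assms(4) unfolding instances_def by blast
  then have "\<forall>n<k. simple_term P m (\<sigma> n)"
    using assms(2) unfolding simple_args_def by blast
  moreover have "simple_clause Sg TE P (k, M)" using assms(1) *(2) by blast
  ultimately show ?thesis unfolding *(1) using simple_clauseD[OF _ \<open>m \<le> 1\<close>] by blast
qed

text \<open>Only the values of a substitution at the bound variables affect the instance, and there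
  only finitely many read arguments are available. Finiteness later allows one finite set of
  separating terms for the whole problem.\<close>

lemma finite_instances:
  fixes cls :: "('c, 'a, 's, 'f, 'p) uclause list"
  assumes cls: "\<forall>(k, M)\<in>set cls. ileaves M \<subseteq> param_leaves P \<union> Var ` {..<k}" and "finite R"
  shows "finite (instances X R cls)"
proof -
  define A where "A = (\<Union>(a, ts)\<in>R. set ts)"
  \<comment> \<open>The fixed default outside the bound variables makes this set of substitutions
    finite.\<close>
  define S where "S k = {\<sigma>. \<forall>n. (n \<in> {..<k} \<longrightarrow> \<sigma> n \<in> A) \<and> (n \<notin> {..<k} \<longrightarrow> \<sigma> n = INum 0)}"
    for k :: nat
  define J where "J = (\<lambda>(k, M). (\<lambda>\<sigma>. xsubst (inst_map \<sigma>) M :: ('c, 'a, 's, 'f, 'p) xqf) ` S k)"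
  have "finite A" using \<open>finite R\<close> unfolding A_def by auto
  then have "finite (S k)" for k
    unfolding S_def by (rule finite_set_of_finite_funs[OF finite_lessThan])
  then have "finite (J cl)" for cl by (simp add: J_def split_def)
  then have "finite (\<Union>cl\<in>set cls. J cl)" by simp
  moreover have "instances X R cls \<subseteq> (\<Union>cl\<in>set cls. J cl)"
  proof
    fix \<phi> assume "\<phi> \<in> instances X R cls"
    then obtain \<sigma> k M where *: "\<phi> = xsubst (inst_map \<sigma>) M" "(k, M) \<in> set cls"
      "\<forall>n<k. \<exists>(a, ts)\<in>R. \<sigma> n \<in> set ts"
      unfolding instances_def by blast
    define \<sigma>' where "\<sigma>' = (\<lambda>n. if n < k then \<sigma> n else INum 0)"
    have "\<sigma> n \<in> A" if "n < k" for n
      using *(3) that unfolding A_def by blast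
    then have "\<sigma>' \<in> S k" unfolding S_def \<sigma>'_def by simp
    moreover have "\<phi> = xsubst (inst_map \<sigma>') M"
      unfolding *(1)
    proof (rule xsubst_cong)
      fix l assume "l \<in> ileaves M"
      then have "l \<in> param_leaves P \<union> Var ` {..<k}" using cls *(2) by blast
      then show "inst_map \<sigma> l = inst_map \<sigma>' l" by (auto simp: \<sigma>'_def)
    qed
    ultimately have "\<phi> \<in> J (k, M)" unfolding J_def by simp
    then show "\<phi> \<in> (\<Union>cl\<in>set cls. J cl)" using *(2) by blast
  qed
  ultimately show ?thesis by (rule finite_subset[rotated])
qed

lemma read_arg_leaves:
  assumes "Rd a ts \<in> els \<phi>" "t \<in> set ts"
  shows "set_iterm t \<subseteq> ileaves \<phi>"
proof
  fix l assume "l \<in> set_iterm t"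
  then have "l \<in> arg_leaves (Rd a ts)" using assms(2) by auto
  then show "l \<in> ileaves \<phi>" unfolding ileaves_def by (rule UnI2[OF UN_I[OF assms(1)]])
qed

lemma ground_reads_subset: "ground_reads G \<subseteq> reads G"
  unfolding ground_reads_def by fast

text \<open>Matrices of clauses contribute ground reads too. Their leaves are parameters or bound
  variables, and groundness with respect to all variables leaves parameters only.\<close>

lemma ground_reads_simple:
  assumes G: "\<forall>\<phi>\<in>G. simple_qf Sg TE P m \<phi>" and cls: "\<forall>cl\<in>set cls. simple_clause Sg TE P cl"
  shows "simple_args P m (ground_reads (G \<union> snd ` set cls))"
proof -
  have "simple_term P m t"
    if at: "(a, ts) \<in> reads (G \<union> snd ` set cls)" and t: "t \<in> set ts" "ground_over UNIV t" for a ts t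
  proof -
    obtain \<phi> where \<phi>: "\<phi> \<in> G \<union> snd ` set cls" "Rd a ts \<in> els \<phi>"
      using at unfolding reads_def by fast
    consider "\<phi> \<in> G" | k where "(k, \<phi>) \<in> set cls"
      using \<phi>(1) by (metis UnE imageE prod.collapse)
    then show ?thesis
    proof cases
      case 1
      with G have "simple_qf Sg TE P m \<phi>" by simp
      from simple_readsD[OF simple_qf_reads[OF this] \<phi>(2)] t(1) show ?thesis by simp
    next
      case 2
      then have "ileaves \<phi> \<subseteq> param_leaves P \<union> Var ` {..<k}"
        using cls simple_clause_leaves by blast
      moreover have "set_iterm t \<subseteq> ileaves \<phi>" by (rule read_arg_leaves[OF \<phi>(2) t(1)])
      ultimately have "param_term P t"
        using t(2) unfolding ground_over_def param_term_def by blast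
      then show ?thesis by (simp add: simple_term_def)
    qed
  qed
  then show ?thesis
    unfolding simple_args_def ground_reads_def by fast
qed

lemma simple_args_subset: "simple_args P m R \<Longrightarrow> R' \<subseteq> R \<Longrightarrow> simple_args P m R'"
  unfolding simple_args_def by blast

section \<open>Boolean closure and Skolemization\<close>

lemma simple_qfE:
  assumes "simple_qf Sg TE P m \<phi>"
  obtains W where "finite W" "\<forall>t\<in>W. param_term P t" "order_invariant Sg TE (Sk 0) W \<phi>"
  using assms unfolding simple_qf_def by fast

lemma simple_qfI:
  assumes "ixs \<phi> \<subseteq> param_leaves P \<union> Sk ` {..<m}" "simple_reads Sg P m \<phi>"
    and "finite W" "\<forall>t\<in>W. param_term P t" "order_invariant Sg TE (Sk 0) W \<phi>"
  shows "simple_qf Sg TE P m \<phi>"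
  using assms unfolding simple_qf_def by fast

lemma simple_qf_Neg:
  assumes "simple_qf Sg TE P m \<phi>"
  shows "simple_qf Sg TE P m (Neg \<phi>)"
proof -
  obtain W where W: "finite W" "\<forall>t\<in>W. param_term P t" "order_invariant Sg TE (Sk 0) W \<phi>"
    using assms by (rule simple_qfE)
  have "order_invariant Sg TE (Sk 0) W (Neg \<phi>)"
    using W(3) unfolding order_invariant_def qeval.simps by fast
  then show ?thesis
    using assms W(1,2) by (intro simple_qfI) (simp_all add: simple_qf_def simple_reads_def)
qed

lemma simple_qf_Disj:
  assumes "simple_qf Sg TE P m \<phi>" "simple_qf Sg TE P m \<psi>"
  shows "simple_qf Sg TE P m (Disj \<phi> \<psi>)"
proof -
  obtain W where W: "finite W" "\<forall>t\<in>W. param_term P t" "order_invariant Sg TE (Sk 0) W \<phi>"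
    using assms(1) by (rule simple_qfE)
  obtain W' where W': "finite W'" "\<forall>t\<in>W'. param_term P t" "order_invariant Sg TE (Sk 0) W' \<psi>"
    using assms(2) by (rule simple_qfE)
  have "order_invariant Sg TE (Sk 0) (W \<union> W') \<phi>" "order_invariant Sg TE (Sk 0) (W \<union> W') \<psi>"
    by (rule order_invariant_mono[OF W(3)], simp) (rule order_invariant_mono[OF W'(3)], simp)
  then have "order_invariant Sg TE (Sk 0) (W \<union> W') (Disj \<phi> \<psi>)"
    unfolding order_invariant_def qeval.simps by fast
  moreover have "finite (W \<union> W')" "\<forall>t\<in>W \<union> W'. param_term P t"
    using W W' by (simp_all add: ball_Un)
  moreover have "simple_reads Sg P m (Disj \<phi> \<psi>)"
    using assms[THEN simple_qf_reads] unfolding simple_reads_def by simp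
  ultimately show ?thesis
    using assms by (intro simple_qfI) (simp_all add: simple_qf_def)
qed

lemma simple_qf_disj_list:
  "\<forall>\<phi>\<in>set \<phi>s. simple_qf Sg TE P m \<phi> \<Longrightarrow> simple_qf Sg TE P m (disj_list \<phi>s)"
proof (induction \<phi>s)
  case Nil
  then show ?case
    unfolding disj_list_def by (intro simple_qf_param) (auto simp: simple_reads_def)
qed (simp add: disj_list_def simple_qf_Disj)

text \<open>Skolemization is the instance that sends \<open>Var n\<close> to \<open>Sk n\<close>, so
  the definition of \<open>simple_clause\<close> covers it; the bound on \<open>k\<close> makes
  these constants simple terms.\<close>

lemma skolem_neg_simple:
  assumes cls: "\<forall>cl\<in>set cls. simple_clause Sg TE P cl" and k: "\<forall>(k, M)\<in>set cls. k \<le> m" and "m \<le> 1"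
  shows "simple_qf Sg TE P m (skolem_neg cls)"
  unfolding skolem_neg_def
proof (rule simple_qf_disj_list, unfold set_map, intro ballI, elim imageE)
  fix cl \<phi>
  assume cl: "cl \<in> set cls" and \<phi>: "\<phi> = (case cl of (k, M) \<Rightarrow>
    Neg (xsubst (\<lambda>l. case l of Var n \<Rightarrow> ILeaf (Sk n) | _ \<Rightarrow> ILeaf l) M))"
  obtain k' M where kM: "cl = (k', M)" by (rule prod.exhaust)
  have "simple_term P m (ILeaf (Sk n))" if "n < k'" for n
    using k cl that unfolding kM by (auto simp: simple_term_def)
  moreover have "simple_clause Sg TE P (k', M)" using cls cl kM by blast
  ultimately have "simple_qf Sg TE P m (xsubst (inst_map (\<lambda>n. ILeaf (Sk n))) M)"
    by (intro simple_clauseD \<open>m \<le> 1\<close>)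
  then show "simple_qf Sg TE P m \<phi>"
    unfolding \<phi> kM prod.case inst_map_def by (rule simple_qf_Neg)
qed

lemma primed_simple:
  assumes "\<forall>cl\<in>set I. simple_clause Sg TE P cl"
  shows "\<forall>cl\<in>set (primed T I). simple_clause Sg TE P cl"
  unfolding primed_def set_map
proof (intro ballI, elim imageE)
  fix cl cl' assume "cl' \<in> set I" "cl = (\<lambda>(k, M). (k, qsubst ILeaf (prime_leaf (NonParam T)) M)) cl'"
  moreover obtain k M where "cl' = (k, M)" by (rule prod.exhaust)
  ultimately show "simple_clause Sg TE P cl"
    using assms by (auto intro: simple_clause_prime)
qed

text \<open>The construction is followed in its own order: simple formulae give reads with simple
  arguments, and these give simple instances. The second round also collects the reads produced by
  the first. Finiteness is carried along in the same way.\<close>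

lemma ground_problem_simple:
  assumes K: "\<forall>cl\<in>set (Axs T). simple_clause Sg TE P cl"
    and U: "\<forall>cl\<in>set (Update Sg T). simple_clause Sg TE P cl"
    and I: "\<forall>cl\<in>set I. simple_clause Sg TE P cl" "\<forall>(k, M)\<in>set I. k \<le> m" "m \<le> 1"
  shows "finite (ground_problem Sg T I) \<and> (\<forall>\<phi>\<in>ground_problem Sg T I. simple_qf Sg TE P m \<phi>)"
proof -
  define G where "G = {skolem_neg (primed T I)}"
  define R1 where "R1 = {(a, ts)\<in>ground_reads (G \<union> snd ` set (Update Sg T)). a \<in> range Nxt}"
  define G1 where "G1 = instances (range Nxt) R1 (Update Sg T)"
  define R2 where "R2 = {(a, ts)\<in>ground_reads (G \<union> G1 \<union> snd ` set (Axs T @ I)). a \<in> range Cur}"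
  define G2 where "G2 = instances (range Cur) R2 (Axs T @ I)"
  have leaves: "\<forall>(k, M)\<in>set cls. ileaves M \<subseteq> param_leaves P \<union> Var ` {..<k}"
    if "\<forall>cl\<in>set cls. simple_clause Sg TE P cl" for cls
    using that simple_clause_leaves by blast
  have KI: "\<forall>cl\<in>set (Axs T @ I). simple_clause Sg TE P cl" using K I(1) by (simp add: ball_Un)
  have k: "\<forall>(k, M)\<in>set (primed T I). k \<le> m" using I(2) by (auto simp: primed_def)
  have G: "finite G" "\<forall>\<phi>\<in>G. simple_qf Sg TE P m \<phi>"
    unfolding G_def using skolem_neg_simple[OF primed_simple[OF I(1)] k I(3)] by simp_all
  have "finite (G \<union> snd ` set (Update Sg T))" using G(1) by simp
  then have "finite R1"
    by (rule finite_subset[OF _ finite_reads, rotated])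
      (use ground_reads_subset in \<open>fastforce simp: R1_def\<close>)
  moreover have "simple_args P m R1"
    by (rule simple_args_subset[OF ground_reads_simple[OF G(2) U]]) (auto simp: R1_def)
  ultimately have G1: "finite G1" "\<forall>\<phi>\<in>G1. simple_qf Sg TE P m \<phi>"
    unfolding G1_def by (simp add: finite_instances[OF leaves[OF U]])
      (intro ballI, rule instances_simple[OF U \<open>simple_args P m R1\<close> I(3)])
  have "finite (G \<union> G1 \<union> snd ` set (Axs T @ I))" using G(1) G1(1) by simp
  then have "finite R2"
    by (rule finite_subset[OF _ finite_reads, rotated])
      (use ground_reads_subset in \<open>fastforce simp: R2_def\<close>)
  moreover have "\<forall>\<phi>\<in>G \<union> G1. simple_qf Sg TE P m \<phi>" using G G1 by blast
  then have "simple_args P m R2"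
    by (intro simple_args_subset[OF ground_reads_simple[OF _ KI]]) (auto simp: R2_def)
  ultimately have G2: "finite G2" "\<forall>\<phi>\<in>G2. simple_qf Sg TE P m \<phi>"
    unfolding G2_def by (simp add: finite_instances[OF leaves[OF KI]])
      (intro ballI, rule instances_simple[OF KI \<open>simple_args P m R2\<close> I(3)])
  have "ground_problem Sg T I = G \<union> G1 \<union> G2"
    unfolding ground_problem_def Let_def G_def R1_def G1_def R2_def G2_def ..
  then show ?thesis using G G1 G2 by (simp add: ball_Un)
qed

section \<open>Congruence axioms\<close>

lemma reads_simple:
  assumes "\<forall>\<phi>\<in>G. simple_qf Sg TE P m \<phi>" "(a, ts) \<in> reads G"
  shows "length ts = arity Sg (base a)" "\<forall>t\<in>set ts. simple_term P m t"
proof -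
  obtain \<phi> where "simple_qf Sg TE P m \<phi>" "Rd a ts \<in> els \<phi>"
    using assms unfolding reads_def by blast
  then show "length ts = arity Sg (base a)" "\<forall>t\<in>set ts. simple_term P m t"
    using simple_readsD[OF simple_qf_reads] by blast+
qed

lemma simple_guard_eqs:
  assumes "\<forall>t\<in>set ts. simple_term P m t" "\<forall>t\<in>set us. simple_term P m t"
  shows "simple_guard P m (conj_list (map2 (\<lambda>t u. At (IEq t u)) ts us))"
  using assms
  by (induction ts us rule: list_induct2') (auto simp: conj_list_def)

text \<open>The premises equate arguments of reads and so form a simple guard; the conclusion has no
  index atom.\<close>

lemma congruences_simple:
  assumes G: "\<forall>\<phi>\<in>G. simple_qf Sg TE P m \<phi>" and "m \<le> 1" and \<phi>: "\<phi> \<in> congruences (reads G)"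
  shows "simple_qf Sg TE P m \<phi>"
proof -
  obtain a ts us where *: "(a, ts) \<in> reads G" "(a, us) \<in> reads G"
    "\<phi> = Imp (conj_list (map2 (\<lambda>t u. At (IEq t u)) ts us))
      (At (EEq (ELeaf (Rd a ts)) (ELeaf (Rd a us))))"
    using \<phi> unfolding congruences_def by blast
  show ?thesis
    unfolding *(3)
    using reads_simple[OF G *(1)] reads_simple[OF G *(2)] \<open>m \<le> 1\<close>
    by (intro simple_qf_guard_Imp simple_guard_eqs) (auto simp: simple_reads_def)
qed

text \<open>The axioms compare arguments of existing reads, so they bring in no new index leaves.
  This is used to show that all their index leaves are kept when \<open>Sk 0\<close> is.\<close>

lemma congruences_leaves:
  assumes "\<phi> \<in> congruences (reads G)"
  shows "ixs \<phi> \<subseteq> (\<Union>\<psi>\<in>G. ileaves \<psi>)"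
proof -
  obtain a ts us where *: "(a, ts) \<in> reads G" "(a, us) \<in> reads G"
    "\<phi> = Imp (conj_list (map2 (\<lambda>t u. At (IEq t u)) ts us))
      (At (EEq (ELeaf (Rd a ts)) (ELeaf (Rd a us))))"
    using assms unfolding congruences_def by blast
  have args: "set_iterm t \<subseteq> (\<Union>\<psi>\<in>G. ileaves \<psi>)" if bvs: "(b, vs) \<in> reads G" "t \<in> set vs" for b vs t
  proof -
    obtain \<psi> where "\<psi> \<in> G" "Rd b vs \<in> els \<psi>" using bvs(1) unfolding reads_def by fast
    with read_arg_leaves[OF this(2) bvs(2)] show ?thesis by blast
  qed
  have "ixs (conj_list (map2 (\<lambda>t u. At (IEq t u)) ts us)) \<subseteq>
      (\<Union>t\<in>set ts. set_iterm t) \<union> (\<Union>t\<in>set us. set_iterm t)"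
    by (induction ts us rule: list_induct2') (auto simp: conj_list_def)
  then have "ixs \<phi> \<subseteq> (\<Union>t\<in>set ts. set_iterm t) \<union> (\<Union>t\<in>set us. set_iterm t)"
    by (simp add: *(3))
  also have "\<dots> \<subseteq> (\<Union>\<psi>\<in>G. ileaves \<psi>)"
    using args[OF *(1)] args[OF *(2)] by (intro Un_least UN_least)
  finally show ?thesis .
qed

lemma finite_congruences:
  assumes "finite R"
  shows "finite (congruences R)"
proof -
  have "congruences R \<subseteq> (\<lambda>((a, ts), (b, us)).
      Imp (conj_list (map2 (\<lambda>t u. At (IEq t u)) ts us))
        (At (EEq (ELeaf (Rd a ts)) (ELeaf (Rd a us))))) ` (R \<times> R)"
    unfolding congruences_def by force
  then show ?thesis using assms finite_subset by blast
qed

section \<open>Quantifier elimination\<close>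

text \<open>The witness for the quantified index constants can be chosen as the given interpretation, so only
  element constants are really eliminated.\<close>

lemma qe_result_order_invariant:
  fixes \<theta> :: "('c, 'a, 's, 'f, 'p) xqf" and TE :: "('s, 'f, 'p, 'u) estruct set"
  assumes qe: "qe_result Sg TE KI KE H \<theta>"
    and kept: "\<And>\<phi>. \<phi> \<in> H \<Longrightarrow> ixs \<phi> \<subseteq> KI"
    and inv: "\<And>\<phi>. \<phi> \<in> H \<Longrightarrow> order_invariant Sg TE x W \<phi>"
  shows "order_invariant Sg TE x W \<theta>"
proof -
  have qe': "qeval E \<iota> \<nu> \<theta> \<longleftrightarrow> (\<exists>\<iota>' \<nu>'. sorted_val Sg E \<nu>' \<and> (\<forall>l\<in>KI. \<iota>' l = \<iota> l) \<and>
      (\<forall>l\<in>KE. \<nu>' l = \<nu> l) \<and> (\<forall>\<phi>\<in>H. qeval E \<iota>' \<nu>' \<phi>))"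
    if "E \<in> TE" "sorted_val Sg E \<nu>" for E \<iota> and \<nu> :: "('c, 'a, 's) eleaf \<Rightarrow> 'u"
    using qe that by (simp add: qe_result_def)
  \<comment> \<open>One direction is enough because \<open>same_side\<close> is symmetric. The
    element part of the witness at \<open>z\<close> is reused at \<open>z'\<close>.\<close>
  have transfer: "qeval E (\<iota>(x := z')) \<nu> \<theta>"
    if E: "E \<in> TE" and \<nu>: "sorted_val Sg E \<nu>" and W: "\<forall>t\<in>W. same_side (ieval \<iota> t) z z'"
      and z: "qeval E (\<iota>(x := z)) \<nu> \<theta>" for E \<iota> z z' and \<nu> :: "('c, 'a, 's) eleaf \<Rightarrow> 'u"
  proof -
    obtain \<iota>' \<nu>' where *: "sorted_val Sg E \<nu>'" "\<forall>l\<in>KI. \<iota>' l = (\<iota>(x := z)) l"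
      "\<forall>l\<in>KE. \<nu>' l = \<nu> l" "\<forall>\<phi>\<in>H. qeval E \<iota>' \<nu>' \<phi>"
      using z unfolding qe'[OF E \<nu>] by (elim exE conjE)
    have "qeval E (\<iota>(x := z')) \<nu>' \<phi>" if \<phi>: "\<phi> \<in> H" for \<phi>
    proof -
      \<comment> \<open>All index leaves of \<open>H\<close> are kept, so the index witness agrees
        on them with the given interpretation.\<close>
      have "qeval E \<iota>' \<nu>' \<phi> = qeval E (\<iota>(x := z)) \<nu>' \<phi>"
      proof (rule qeval_cong)
        show "\<iota>' l = (\<iota>(x := z)) l" if "l \<in> ixs \<phi>" for l
          by (rule bspec[OF *(2) subsetD[OF kept[OF \<phi>] that]])
      qed (rule refl)
      also have "\<dots> = qeval E (\<iota>(x := z')) \<nu>' \<phi>"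
        by (rule order_invariantD[OF inv[OF \<phi>] E *(1) W])
      finally show ?thesis using bspec[OF *(4) \<phi>] by simp
    qed
    then show ?thesis
      unfolding qe'[OF E \<nu>] using *(1,3)
      by (intro exI[of _ "\<iota>(x := z')"] exI[of _ \<nu>'] conjI ballI) simp_all
  qed
  have sym: "same_side d z' z" if "same_side d z z'" for d z z'
    using that by (simp add: same_side_def)
  show ?thesis
    unfolding order_invariant_def
  proof (intro ballI allI impI)
    fix E \<iota> z z' and \<nu> :: "('c, 'a, 's) eleaf \<Rightarrow> 'u"
    assume E: "E \<in> TE" and \<nu>: "sorted_val Sg E \<nu>" and W: "\<forall>t\<in>W. same_side (ieval \<iota> t) z z'"
    from W have W': "\<forall>t\<in>W. same_side (ieval \<iota> t) z' z" using sym by simp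
    show "qeval E (\<iota>(x := z)) \<nu> \<theta> = qeval E (\<iota>(x := z')) \<nu> \<theta>"
      using transfer[OF E \<nu> W] transfer[OF E \<nu> W'] by (rule iffI)
  qed
qed

text \<open>Invariance relative to a set passes to larger sets, so the union of the finitely many
  sets works for all formulae at once.\<close>

lemma simple_qf_common_terms:
  assumes "finite H" "\<forall>\<phi>\<in>H. simple_qf Sg TE P m \<phi>"
  shows "\<exists>W. finite W \<and> (\<forall>t\<in>W. param_term P t) \<and>
    (\<forall>\<phi>\<in>H. order_invariant Sg TE (Sk 0) W \<phi>)"
  using assms
proof (induction H rule: finite_induct)
  case empty
  then show ?case by (intro exI[of _ "{}"]) simp
next
  case (insert \<phi> H)
  then obtain W where W: "finite W" "\<forall>t\<in>W. param_term P t"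
    "\<forall>\<phi>\<in>H. order_invariant Sg TE (Sk 0) W \<phi>" by auto
  have "simple_qf Sg TE P m \<phi>" using insert.prems by simp
  then obtain W' where W': "finite W'" "\<forall>t\<in>W'. param_term P t"
    "order_invariant Sg TE (Sk 0) W' \<phi>" by (rule simple_qfE)
  have "order_invariant Sg TE (Sk 0) (W \<union> W') \<psi>" if "\<psi> \<in> insert \<phi> H" for \<psi>
    using that W(3) W'(3) by (auto intro: order_invariant_mono)
  then show ?case using W(1,2) W'(1,2) by (intro exI[of _ "W \<union> W'"]) (simp add: ball_Un)
qed

lemma kept_indices_leaves: "kept_indices P G \<subseteq> (\<Union>\<phi>\<in>G. ileaves \<phi>)"
  unfolding kept_indices_def by (rule Collect_subset)

text \<open>Invariance is trivial if no index atom of \<open>\<theta>\<close> mentions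
  \<open>Sk 0\<close>. Otherwise all index leaves of the problem turn out to be kept and
  \<open>qe_result_order_invariant\<close> applies.\<close>

lemma qe_result_simple:
  assumes G: "finite G" "\<forall>\<phi>\<in>G. simple_qf Sg TE P m \<phi>" and "m \<le> 1"
    and qe: "qe_result Sg TE (kept_indices P G) (kept_elements P G) (G \<union> congruences (reads G)) \<theta>"
  shows "simple_qf Sg TE P m \<theta>"
proof -
  define KI where "KI = kept_indices P G"
  define H where "H = G \<union> congruences (reads G)"
  have H: "finite H" "\<forall>\<phi>\<in>H. simple_qf Sg TE P m \<phi>"
    unfolding H_def
    using G finite_congruences[OF finite_reads[OF G(1)]] congruences_simple[OF G(2) \<open>m \<le> 1\<close>]
    by (simp_all add: ball_Un)
  have leaves: "(\<Union>\<phi>\<in>G. ileaves \<phi>) \<subseteq> param_leaves P \<union> Sk ` {..<m}"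
    by (rule UN_least, rule simple_qf_ileaves[OF bspec[OF G(2)]])
  have ixs: "ixs \<phi> \<subseteq> (\<Union>\<phi>\<in>G. ileaves \<phi>)" if "\<phi> \<in> H" for \<phi>
  proof (cases "\<phi> \<in> G")
    case True
    have "ixs \<phi> \<subseteq> ileaves \<phi>" by (simp add: ileaves_def)
    with True show ?thesis by (rule UN_upper[THEN order_trans[rotated]])
  next
    case False
    with that have "\<phi> \<in> congruences (reads G)" by (simp add: H_def)
    then show ?thesis by (rule congruences_leaves)
  qed
  have KI: "KI \<subseteq> param_leaves P \<union> Sk ` {..<m}"
    unfolding KI_def using kept_indices_leaves leaves by (rule order_trans)
  have \<theta>: "ixs \<theta> \<subseteq> KI" "els \<theta> \<subseteq> kept_elements P G"
    using qe unfolding qe_result_def KI_def by simp_all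
  have reads: "simple_reads Sg P m \<theta>"
    unfolding simple_reads_def
  proof (intro allI impI)
    fix a ts assume "Rd a ts \<in> els \<theta>"
    with \<theta>(2) have "Rd a ts \<in> kept_elements P G" by (rule subsetD)
    then have "(a, ts) \<in> reads G" by (auto simp: kept_elements_def)
    from reads_simple[OF G(2) this]
    show "length ts = arity Sg (base a) \<and> (\<forall>t\<in>set ts. simple_term P m t)" by (rule conjI)
  qed
  obtain W where W: "finite W" "\<forall>t\<in>W. param_term P t"
    "\<forall>\<phi>\<in>H. order_invariant Sg TE (Sk 0) W \<phi>"
    using simple_qf_common_terms[OF H] by (elim exE conjE)
  have "order_invariant Sg TE (Sk 0) W \<theta>"
  proof (cases "Sk 0 \<in> ixs \<theta>")
    case True
    have kept: "ixs \<phi> \<subseteq> KI" if "\<phi> \<in> H" for \<phi>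
    proof
      fix l assume "l \<in> ixs \<phi>"
      with ixs[OF that] have l: "l \<in> (\<Union>\<phi>\<in>G. ileaves \<phi>)" by (rule subsetD)
      \<comment> \<open>Occurring parameters are kept by definition; \<open>Sk 0\<close> is kept
        because \<open>\<theta>\<close> contains it and has only kept index leaves.\<close>
      with leaves consider "l \<in> param_leaves P" | "l = Sk 0" using \<open>m \<le> 1\<close> by auto
      then show "l \<in> KI"
      proof cases
        case 1
        then have "\<exists>c. l = Con c \<and> IxC c \<in> P" by (simp add: param_leaves_def)
        with l show ?thesis unfolding KI_def kept_indices_def by (intro CollectI conjI disjI1)
      qed (use True \<theta>(1) in \<open>simp add: subset_iff\<close>)
    qed
    show ?thesis
      by (rule qe_result_order_invariant[OF qe[folded KI_def H_def] kept bspec[OF W(3)]])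
  qed (rule order_invariant_not_in)
  with reads W(1,2) show ?thesis
    using order_trans[OF \<theta>(1) KI] by (intro simple_qfI)
qed

section \<open>The iterates\<close>

text \<open>The substitution by which \<open>symbol_elimination\<close> turns Skolem constants back
  into variables, named for reuse.\<close>

definition unskolem :: "'c ileaf \<Rightarrow> 'c ileaf iterm" where
  "unskolem l = (case l of Sk n \<Rightarrow> ILeaf (Var n) | _ \<Rightarrow> ILeaf l)"

lemma unskolem_simps [simp]:
  "unskolem (Sk n) = ILeaf (Var n)" "l \<in> param_leaves P \<Longrightarrow> unskolem l = ILeaf l"
  by (auto simp: unskolem_def param_leaves_def)

lemma arg_leaves_lsubst [simp]:
  "arg_leaves (lsubst \<sigma> r) = (\<Union>l\<in>arg_leaves r. set_iterm (\<sigma> l))"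
  by (cases r) auto

lemma ileaves_xsubst: "ileaves (xsubst \<sigma> \<phi>) = (\<Union>l\<in>ileaves \<phi>. set_iterm (\<sigma> l))"
  by (simp add: ileaves_def xsubst_def)

lemma ileaves_Neg: "ileaves (Neg \<phi>) = ileaves \<phi>"
  by (simp add: ileaves_def)

lemma sorted_val_lsubst:
  "sorted_val Sg E \<nu> \<Longrightarrow> sorted_val Sg E (\<lambda>l. \<nu> (lsubst \<sigma> l))"
  unfolding sorted_val_def by (metis leaf_sort_lsubst)

lemma simple_term_isubst:
  assumes "simple_term P m t"
    and "\<And>n. n < m \<Longrightarrow> simple_term P m' (\<rho> (Sk n))" "\<And>l. l \<in> param_leaves P \<Longrightarrow> \<rho> l = ILeaf l"
  shows "simple_term P m' (isubst \<rho> t)"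
proof (cases "param_term P t")
  case True
  then have "isubst \<rho> t = t"
    using assms(3) by (intro isubst_id_on) (auto simp: param_term_def)
  with True show ?thesis by (simp add: simple_term_def)
next
  case False
  then obtain n where "n < m" "t = ILeaf (Sk n)" using assms(1) by (auto simp: simple_term_def)
  then show ?thesis using assms(2) by simp
qed

lemma simple_reads_xsubst:
  assumes "simple_reads Sg P m \<phi>"
    and "\<And>n. n < m \<Longrightarrow> simple_term P m' (\<rho> (Sk n))" "\<And>l. l \<in> param_leaves P \<Longrightarrow> \<rho> l = ILeaf l"
  shows "simple_reads Sg P m' (xsubst \<rho> \<phi>)"
  unfolding simple_reads_def
proof (intro allI impI)
  fix a ts assume "Rd a ts \<in> els (xsubst \<rho> \<phi>)"
  then obtain r where r: "r \<in> els \<phi>" "Rd a ts = lsubst \<rho> r"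
    unfolding xsubst_def els_qsubst by (elim imageE)
  then obtain us where us: "r = Rd a us" "ts = map (isubst \<rho>) us"
    by (cases r rule: eleaf.exhaust) auto
  have "length us = arity Sg (base a)" "\<forall>u\<in>set us. simple_term P m u"
    using simple_readsD[OF assms(1)] r(1) us(1) by blast+
  then show "length ts = arity Sg (base a) \<and> (\<forall>t\<in>set ts. simple_term P m' t)"
    using simple_term_isubst[of P m _ m' \<rho>, OF _ assms(2,3)] unfolding us(2) by simp
qed

text \<open>This admits \<Gamma>, in the form in which it is computed, to the next iterate. Undoing
  Skolemization and instantiating again amounts to the single substitution \<open>\<rho>\<close>
  that sends \<open>Sk n\<close> to \<open>\<sigma> n\<close>.\<close>

lemma simple_clause_unskolem:
  fixes \<theta> :: "('c, 'a, 's, 'f, 'p) xqf" and TE :: "('s, 'f, 'p, 'u) estruct set"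
  assumes \<theta>: "simple_qf Sg TE P m \<theta>" and "m \<le> 1"
  shows "simple_clause Sg TE P (m, Neg (xsubst unskolem \<theta>))"
proof -
  have leaves: "ileaves \<theta> \<subseteq> param_leaves P \<union> Sk ` {..<m}"
    by (rule simple_qf_ileaves[OF \<theta>])
  have ixs: "ixs \<theta> \<subseteq> param_leaves P \<union> Sk ` {..<m}"
    using \<theta> by (simp add: simple_qf_def)
  obtain W where W: "finite W" "\<forall>t\<in>W. param_term P t" "order_invariant Sg TE (Sk 0) W \<theta>"
    using \<theta> by (rule simple_qfE)
  have "set_iterm (unskolem l) \<subseteq> param_leaves P \<union> Var ` {..<m}" if "l \<in> ileaves \<theta>" for l
    using that leaves by auto
  then have "ileaves (Neg (xsubst unskolem \<theta>)) \<subseteq> param_leaves P \<union> Var ` {..<m}"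
    unfolding ileaves_Neg ileaves_xsubst by (rule UN_least)
  moreover have "simple_qf Sg TE P m' (xsubst (inst_map \<sigma>) (Neg (xsubst unskolem \<theta>)))"
    if "m' \<le> 1" and \<sigma>: "\<forall>n<m. simple_term P m' (\<sigma> n)" for \<sigma> m'
  proof -
    define \<rho> where "\<rho> = (\<lambda>l. isubst (inst_map \<sigma>) (unskolem l))"
    have \<rho>: "\<rho> l = ILeaf l" if "l \<in> param_leaves P" for l
      using that by (simp add: \<rho>_def)
    have \<rho>': "\<rho> (Sk n) = \<sigma> n" for n by (simp add: \<rho>_def)
    have "set_iterm (\<rho> l) \<subseteq> param_leaves P \<union> Sk ` {..<m'}" if "l \<in> ixs \<theta>" for l
    proof -
      have "l \<in> param_leaves P \<union> Sk ` {..<m}" using ixs that by (rule subsetD)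
      then consider "l \<in> param_leaves P" | n where "n < m" "l = Sk n" by auto
      then show ?thesis
      proof cases
        case 2
        then show ?thesis using \<sigma> simple_term_leaves[of P m' "\<sigma> n"] by (simp add: \<rho>')
      qed (simp add: \<rho>)
    qed
    then have ixs': "ixs (xsubst \<rho> \<theta>) \<subseteq> param_leaves P \<union> Sk ` {..<m'}"
      unfolding xsubst_def ixs_qsubst by (rule UN_least)
    have reads: "simple_reads Sg P m' (xsubst \<rho> \<theta>)"
      using \<sigma> by (intro simple_reads_xsubst[OF simple_qf_reads[OF \<theta>]]) (simp_all add: \<rho> \<rho>')
    have inv: "order_invariant Sg TE (Sk 0) W (xsubst \<rho> \<theta>)"
    proof (cases "Sk 0 \<in> ixs (xsubst \<rho> \<theta>)")
      case True
      then obtain l where l: "l \<in> ixs \<theta>" "Sk 0 \<in> set_iterm (\<rho> l)"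
        unfolding xsubst_def ixs_qsubst by (elim UN_E)
      have "l \<notin> param_leaves P" using l(2) by (auto simp: \<rho>)
      moreover have "l \<in> param_leaves P \<union> Sk ` {..<m}" using ixs l(1) by (rule subsetD)
      ultimately have "l = Sk 0" "0 < m" using \<open>m \<le> 1\<close> by auto
      then have "Sk 0 \<in> set_iterm (\<sigma> 0)" "simple_term P m' (\<sigma> 0)" using l(2) \<sigma> by (simp_all add: \<rho>')
      \<comment> \<open>A simple term that contains \<open>Sk 0\<close> is \<open>Sk 0\<close>
        itself. Hence \<open>\<rho>\<close> is the identity on the leaves of index atoms, and its
        action on reads is absorbed by the valuation.\<close>
      then have "\<sigma> 0 = ILeaf (Sk 0)" using \<open>m' \<le> 1\<close>
        by (auto simp: simple_term_def param_term_def)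
      have id: "\<rho> l = ILeaf l" if l: "l \<in> ixs \<theta>" for l
      proof -
        have "l \<in> param_leaves P \<union> Sk ` {..<m}" using ixs l by (rule subsetD)
        then consider "l \<in> param_leaves P" | "l = Sk 0" using \<open>m \<le> 1\<close> by auto
        then show ?thesis by cases (simp_all add: \<rho> \<rho>' \<open>\<sigma> 0 = ILeaf (Sk 0)\<close>)
      qed
      have eq: "qeval E \<iota> \<nu> (xsubst \<rho> \<theta>) = qeval E \<iota> (\<lambda>l. \<nu> (lsubst \<rho> l)) \<theta>"
        for E \<iota> and \<nu> :: "('c, 'a, 's) eleaf \<Rightarrow> 'u"
        unfolding xsubst_def qeval_qsubst by (rule qeval_cong) (simp_all add: id)
      show ?thesis
        unfolding order_invariant_def eq
        by (intro ballI allI impI order_invariantD[OF W(3)] sorted_val_lsubst) simp_all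
    qed (rule order_invariant_not_in)
    have "simple_qf Sg TE P m' (xsubst \<rho> \<theta>)"
      using ixs' reads W(1,2) inv by (rule simple_qfI)
    then have "simple_qf Sg TE P m' (Neg (xsubst \<rho> \<theta>))" by (rule simple_qf_Neg)
    moreover have "xsubst (inst_map \<sigma>) (Neg (xsubst unskolem \<theta>)) = Neg (xsubst \<rho> \<theta>)"
      using xsubst_xsubst[of "inst_map \<sigma>" unskolem \<theta>] by (simp add: xsubst_def \<rho>_def)
    ultimately show ?thesis by simp
  qed
  ultimately show ?thesis by (simp add: simple_clause_def)
qed

section \<open>Clause shapes recovered from the array property fragment\<close>

lemma alls_Qf_inject: "alls vs (Qf M) = alls ws (Qf N) \<longleftrightarrow> vs = ws \<and> M = N"
proof (induction vs arbitrary: ws)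
  case Nil
  then show ?case by (cases ws) (auto simp: alls_def)
next
  case (Cons v vs)
  then show ?case by (cases ws) (auto simp: alls_def)
qed

text \<open>A formula determines its quantifier prefix and matrix, so the guard and constraint of
  the rule are those of \<open>M\<close>.\<close>

lemma array_property_allsD:
  assumes "array_property (alls [0..<k] (Qf M))"
  shows "\<exists>\<phi> \<psi>. M = Imp \<phi> \<psi> \<and> index_guard {..<k} \<phi> \<and> value_constraint {..<k} \<psi>"
  using assms
proof cases
  case (1 vs \<phi> \<psi>)
  then have "[0..<k] = vs" "M = Imp \<phi> \<psi>" by (auto simp: alls_Qf_inject)
  then show ?thesis using 1 by (auto simp: lessThan_atLeast0)
qed

lemma not_array_property_FConj: "\<not> array_property (FConj \<phi> \<psi>)"
proof
  assume "array_property (FConj \<phi> \<psi>)"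
  then show False
  proof cases
    case (1 vs \<phi>I \<phi>V)
    then show False by (cases vs) (auto simp: alls_def)
  qed
qed

lemma apf_body_FConjD:
  assumes "apf_body (FConj \<phi> \<psi>)"
  shows "apf_body \<phi>" "apf_body \<psi>"
  using assms not_array_property_FConj by (auto elim: apf_body.cases)

text \<open>For positive \<open>k\<close> the formula starts with a quantifier, and among the rules
  of \<open>apf_body\<close> only the one for array properties produces such a formula.\<close>

lemma apf_body_allsD:
  assumes "apf_body (alls [0..<k] (Qf M))"
  shows "k = 0 \<or> (\<exists>\<phi> \<psi>. M = Imp \<phi> \<psi> \<and> index_guard {..<k} \<phi> \<and> value_constraint {..<k} \<psi>)"
proof (cases k)
  case (Suc k')
  then have "alls [0..<k] (Qf M) = AllI 0 (alls [1..<k] (Qf M))"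
    by (simp add: alls_def upt_conv_Cons del: upt_Suc)
  with assms have "array_property (alls [0..<k] (Qf M))"
    by cases auto
  then show ?thesis by (intro disjI2 array_property_allsD)
qed simp

lemma apf_body_univ_fmD:
  "apf_body (univ_fm cls) \<Longrightarrow> cl \<in> set cls \<Longrightarrow> apf_body (clause_fm cl)"
  by (induction cls) (auto simp: univ_fm_def dest: apf_body_FConjD)

lemma array_property_fragment_clauseD:
  assumes "array_property_fragment (univ_fm cls)" "(k, M) \<in> set cls"
  shows "k = 0 \<or> (\<exists>\<phi> \<psi>. M = Imp \<phi> \<psi> \<and> index_guard {..<k} \<phi> \<and> value_constraint {..<k} \<psi>)"
proof -
  have "ex_apf (univ_fm cls)" using assms(1) by (simp add: array_property_fragment_def)
  \<comment> \<open>A universal formula starts with \<open>Qf\<close> or \<open>FConj\<close>, which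
    rules out an existential prefix.\<close>
  then have "apf_body (univ_fm cls)"
    by (cases rule: ex_apf.cases) (auto simp: univ_fm_def dest: sym split: list.splits, (cases cls; simp)+)
  from apf_body_univ_fmD[OF this assms(2)] show ?thesis by (intro apf_body_allsD) simp
qed

section \<open>Well-formed clauses and update rules\<close>

lemma wf_matrix_leaves:
  assumes wf: "wf_matrix Sg S Y k M" and S: "\<And>c. IxC c \<in> S \<Longrightarrow> IxC c \<in> P"
  shows "ileaves M \<subseteq> param_leaves P \<union> Var ` {..<k}"
proof
  fix l assume "l \<in> ileaves M"
  with wf have "case l of Var n \<Rightarrow> n < k | Con c \<Rightarrow> IxC c \<in> S | Sk n \<Rightarrow> False"
    by (simp add: wf_matrix_def)
  then show "l \<in> param_leaves P \<union> Var ` {..<k}"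
    using S by (cases l rule: ileaf.exhaust) auto
qed

lemma wf_matrix_length:
  assumes "wf_matrix Sg S Y k M" "Rd a ts \<in> els M"
  shows "length ts = arity Sg (base a)"
  using assms by (fastforce simp: wf_matrix_def)

lemma simple_clauses_wf:
  assumes "wf_clauses Sg S cls" "array_property_fragment (univ_fm cls)"
    and S: "\<And>c. IxC c \<in> S \<Longrightarrow> IxC c \<in> P"
  shows "\<forall>cl\<in>set cls. simple_clause Sg TE P cl"
proof
  fix cl assume cl: "cl \<in> set cls"
  obtain k M where kM: "cl = (k, M)" by (rule prod.exhaust)
  then have wf: "wf_matrix Sg S {} k M" using assms(1) cl by (auto simp: wf_clauses_def)
  show "simple_clause Sg TE P cl"
    unfolding kM
    using wf_matrix_leaves[OF wf S] wf_matrix_length[OF wf]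
      array_property_fragment_clauseD[OF assms(2) cl[unfolded kM]]
    by (rule simple_clause_apf)
qed

lemma ixs_conj_list [simp]: "ixs (conj_list \<phi>s) = (\<Union>\<phi>\<in>set \<phi>s. ixs \<phi>)"
  by (induction \<phi>s) (auto simp: conj_list_def)

lemma els_conj_list [simp]: "els (conj_list \<phi>s) = (\<Union>\<phi>\<in>set \<phi>s. els \<phi>)"
  by (induction \<phi>s) (auto simp: conj_list_def)

lemma ileaves_conj_list: "ileaves (conj_list \<phi>s) = (\<Union>\<phi>\<in>set \<phi>s. ileaves \<phi>)"
  by (auto simp: ileaves_def)

lemma els_subst_new:
  "r \<in> els (subst_new Sg f \<phi>) \<Longrightarrow>
    r \<in> els \<phi> \<or> r = Rd (Nxt f) (map (\<lambda>n. ILeaf (Var n)) [0..<arity Sg f])"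
  by (auto simp: subst_new_def)

lemma ileaves_subst_new:
  "ileaves (subst_new Sg f \<phi>) \<subseteq> ileaves \<phi> \<union> Var ` {..<arity Sg f}"
  unfolding ileaves_def
proof (intro Un_least UN_least)
  fix r assume "r \<in> els (subst_new Sg f \<phi>)"
  from els_subst_new[OF this]
  show "arg_leaves r \<subseteq> ixs \<phi> \<union> (\<Union>l\<in>els \<phi>. arg_leaves l) \<union> Var ` {..<arity Sg f}"
    by (elim disjE) auto
qed (auto simp: subst_new_def)

text \<open>Replacing \<open>y\<close> by the new value adds only the read of \<open>Nxt f\<close>
  at the bare variables, as many as the arity of \<open>f\<close>. All other leaves come from
  well-formed rules, and the guard form comes from membership in the fragment.\<close>

lemma update_simple:
  assumes T: "transition_system Sg TE T" and S: "\<And>c. IxC c \<in> Param T \<union> NonParam T \<Longrightarrow> IxC c \<in> P"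
    and apf: "array_property_fragment (univ_fm (Update Sg T))"
  shows "\<forall>cl\<in>set (Update Sg T). simple_clause Sg TE P cl"
proof
  fix cl assume cl: "cl \<in> set (Update Sg T)"
  then obtain f \<phi> Cs where f: "f \<in> set (Upd T)" "(\<phi>, Cs) \<in> set (rules T f)"
    and cl_eq: "cl = (arity Sg f, Imp \<phi> (subst_new Sg f (conj_list Cs)))"
    by (auto simp: Update_def update_of_def)
  let ?S = "Param T \<union> NonParam T" and ?k = "arity Sg f"
  have wf: "wf_matrix Sg ?S {} ?k \<phi>" "\<forall>C\<in>set Cs. wf_matrix Sg ?S {(rsort Sg f, 0)} ?k C"
    using T f unfolding transition_system_def Let_def by fast+
  have "ileaves (conj_list Cs) \<subseteq> param_leaves P \<union> Var ` {..<?k}"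
    unfolding ileaves_conj_list by (rule UN_least, rule wf_matrix_leaves[OF bspec[OF wf(2)] S])
  then have "ileaves (subst_new Sg f (conj_list Cs)) \<subseteq> param_leaves P \<union> Var ` {..<?k}"
    using ileaves_subst_new[of Sg f "conj_list Cs"] by fast
  moreover have "ileaves \<phi> \<subseteq> param_leaves P \<union> Var ` {..<?k}"
    by (rule wf_matrix_leaves[OF wf(1) S])
  ultimately have leaves: "ileaves (Imp \<phi> (subst_new Sg f (conj_list Cs))) \<subseteq>
      param_leaves P \<union> Var ` {..<?k}"
    by (simp add: ileaves_def)
  have len: "length ts = arity Sg (base a)"
    if r: "Rd a ts \<in> els (Imp \<phi> (subst_new Sg f (conj_list Cs)))" for a ts
  proof -
    consider "Rd a ts \<in> els \<phi>" | "Rd a ts \<in> els (subst_new Sg f (conj_list Cs))"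
      using r unfolding qf.set by (elim UnE)
    then show ?thesis
    proof cases
      case 1
      with wf(1) show ?thesis by (rule wf_matrix_length)
    next
      case 2
      from els_subst_new[OF this] show ?thesis
      proof
        assume "Rd a ts \<in> els (conj_list Cs)"
        then obtain C where "C \<in> set Cs" "Rd a ts \<in> els C" unfolding els_conj_list by (elim UN_E)
        then show ?thesis using wf(2) wf_matrix_length by blast
      qed simp
    qed
  qed
  show "simple_clause Sg TE P cl"
    unfolding cl_eq
    using leaves len array_property_fragment_clauseD[OF apf cl[unfolded cl_eq]]
    by (rule simple_clause_apf)
qed

section \<open>One elimination step and the induction on iterates\<close>

lemma num_vars_ge: "(k, M) \<in> set cls \<Longrightarrow> k \<le> num_vars cls"
  unfolding num_vars_def by (rule Max_ge) force+

lemma num_vars_le: "\<forall>(k, M)\<in>set cls. k \<le> m \<Longrightarrow> num_vars cls \<le> m"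
  unfolding num_vars_def by (subst Max_le_iff) auto

text \<open>Here \<open>m\<close> is the number of variables of \<open>I\<close>. The reads of
  \<open>\<theta>\<close> are kept constants, hence unprimed parameters; the final clauses have to
  be built from such symbols only.\<close>

lemma symbol_elimination_simple:
  assumes K: "\<forall>cl\<in>set (Axs T). simple_clause Sg TE (Param T) cl"
    and U: "\<forall>cl\<in>set (Update Sg T). simple_clause Sg TE (Param T) cl"
    and I: "\<forall>cl\<in>set I. simple_clause Sg TE (Param T) cl" "\<forall>(k, M)\<in>set I. k \<le> 1"
    and "symbol_elimination Sg TE T I \<Gamma>"
  shows "\<exists>m \<theta>. m \<le> 1 \<and> \<Gamma> = (m, Neg (xsubst unskolem \<theta>)) \<and> simple_qf Sg TE (Param T) m \<theta> \<and>
    wt_qf Sg (leaf_sort Sg) \<theta> \<and> (\<forall>r\<in>els \<theta>. \<exists>g ts. r = Rd (Cur g) ts \<and> Arr g \<in> Param T)"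
proof -
  let ?G = "ground_problem Sg T I" and ?m = "num_vars I"
  have m: "?m \<le> 1" using I(2) by (rule num_vars_le)
  obtain \<theta> where qe: "qe_result Sg TE (kept_indices (Param T) ?G) (kept_elements (Param T) ?G)
      (?G \<union> congruences (reads ?G)) \<theta>"
    and \<Gamma>: "\<Gamma> = (?m, Neg (xsubst (\<lambda>l. case l of Sk n \<Rightarrow> ILeaf (Var n) | _ \<Rightarrow> ILeaf l) \<theta>))"
    using assms(5) unfolding symbol_elimination_def Let_def by (elim exE conjE)
  have "finite ?G" "\<forall>\<phi>\<in>?G. simple_qf Sg TE (Param T) ?m \<phi>"
    using ground_problem_simple[OF K U I(1) _ m] num_vars_ge by blast+
  from qe_result_simple[OF this m qe] have "simple_qf Sg TE (Param T) ?m \<theta>" .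
  moreover have "wt_qf Sg (leaf_sort Sg) \<theta>" "els \<theta> \<subseteq> kept_elements (Param T) ?G"
    using qe by (simp_all add: qe_result_def)
  moreover have "\<exists>g ts. r = Rd (Cur g) ts \<and> Arr g \<in> Param T"
    if "r \<in> kept_elements (Param T) ?G" for r
    using that unfolding kept_elements_def by blast
  moreover have "\<Gamma> = (?m, Neg (xsubst unskolem \<theta>))"
    unfolding \<Gamma> unskolem_def ..
  ultimately show ?thesis using m by blast
qed

lemma iterate_simple:
  assumes "iterate Sg TE T \<Psi> n I"
    and K: "\<forall>cl\<in>set (Axs T). simple_clause Sg TE (Param T) cl"
    and U: "\<forall>cl\<in>set (Update Sg T). simple_clause Sg TE (Param T) cl"
    and \<Psi>: "\<forall>cl\<in>set \<Psi>. simple_clause Sg TE (Param T) cl \<and> fst cl \<le> 1"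
  shows "\<forall>cl\<in>set I. simple_clause Sg TE (Param T) cl \<and> fst cl \<le> 1"
  using assms(1)
\<comment> \<open>No rule for \<open>iterate\<close> has a premise about \<open>generated\<close>,
  so the second induction predicate can be trivially true.\<close>
proof (induction rule: iterate_generated.inducts(1)[where ?P2.0 = "\<lambda>_ _. True"])
  case (strengthen n I \<Gamma>)
  then have I: "\<forall>cl\<in>set I. simple_clause Sg TE (Param T) cl" "\<forall>(k, M)\<in>set I. k \<le> 1" by auto
  obtain m \<theta> where "m \<le> 1" "\<Gamma> = (m, Neg (xsubst unskolem \<theta>))"
    "simple_qf Sg TE (Param T) m \<theta>"
    using symbol_elimination_simple[OF K U I \<open>symbol_elimination Sg TE T I \<Gamma>\<close>] by (elim exE conjE)
  then have "simple_clause Sg TE (Param T) \<Gamma> \<and> fst \<Gamma> \<le> 1"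
    by (simp add: simple_clause_unskolem)
  with strengthen.IH show ?case by simp
qed (use \<Psi> in simp_all)

section \<open>Clauses guarded by a position\<close>

definition disj_clauses ::
  "('k, 'l, 'f, 'p) qf list \<Rightarrow> ('k, 'l, 'f, 'p) qf list \<Rightarrow> ('k, 'l, 'f, 'p) qf list" where
  "disj_clauses cs ds = concat (map (\<lambda>c. map (Disj c) ds) cs)"

text \<open>The flag is the polarity: \<open>True\<close> asks for clauses of the formula,
  \<open>False\<close> for clauses of its negation. Negations are thus pushed to the atoms in the
  same recursion that distributes disjunctions.\<close>

fun cnf :: "bool \<Rightarrow> ('k, 'l, 'f, 'p) qf \<Rightarrow> ('k, 'l, 'f, 'p) qf list" where
  "cnf b Tru = (if b then [] else [Fls])"
| "cnf b Fls = (if b then [Fls] else [])"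
| "cnf b (At a) = [if b then At a else Neg (At a)]"
| "cnf b (Neg \<phi>) = cnf (\<not> b) \<phi>"
| "cnf b (Conj \<phi> \<psi>) = (if b then cnf b \<phi> @ cnf b \<psi> else disj_clauses (cnf b \<phi>) (cnf b \<psi>))"
| "cnf b (Disj \<phi> \<psi>) = (if b then disj_clauses (cnf b \<phi>) (cnf b \<psi>) else cnf b \<phi> @ cnf b \<psi>)"
| "cnf b (Imp \<phi> \<psi>) =
    (if b then disj_clauses (cnf False \<phi>) (cnf True \<psi>) else cnf True \<phi> @ cnf False \<psi>)"

lemma set_disj_clauses: "set (disj_clauses cs ds) = {Disj c d | c d. c \<in> set cs \<and> d \<in> set ds}"
  by (auto simp: disj_clauses_def)

lemma disj_clauses_qeval:
  "(\<forall>c\<in>set (disj_clauses cs ds). qeval E \<iota> \<nu> c) \<longleftrightarrow>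
    (\<forall>c\<in>set cs. qeval E \<iota> \<nu> c) \<or> (\<forall>d\<in>set ds. qeval E \<iota> \<nu> d)"
  unfolding set_disj_clauses by fastforce

lemma cnf_qeval: "(\<forall>c\<in>set (cnf b \<phi>). qeval E \<iota> \<nu> c) \<longleftrightarrow> qeval E \<iota> \<nu> \<phi> = b"
  by (induction b \<phi> rule: cnf.induct) (auto simp: disj_clauses_qeval ball_Un)

lemma cnf_literal_disj: "c \<in> set (cnf b \<phi>) \<Longrightarrow> literal_disj c"
  by (induction b \<phi> arbitrary: c rule: cnf.induct)
    (auto simp: set_disj_clauses split: if_splits)

lemma cnf_wt: "c \<in> set (cnf b \<phi>) \<Longrightarrow> wt_qf Sg ls \<phi> \<Longrightarrow> wt_qf Sg ls c"
  by (induction b \<phi> arbitrary: c rule: cnf.induct)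
    (auto simp: set_disj_clauses split: if_splits)

lemma cnf_ixs: "c \<in> set (cnf b \<phi>) \<Longrightarrow> l \<in> ixs c \<Longrightarrow> l \<in> ixs \<phi>"
  by (induction b \<phi> arbitrary: c rule: cnf.induct)
    (auto simp: set_disj_clauses split: if_splits, blast+)

lemma cnf_els: "c \<in> set (cnf b \<phi>) \<Longrightarrow> r \<in> els c \<Longrightarrow> r \<in> els \<phi>"
  by (induction b \<phi> arbitrary: c rule: cnf.induct)
    (auto simp: set_disj_clauses split: if_splits, blast+)

text \<open>One conjunction of atoms for each of the three positions. Guards of the fragment have
  neither negation nor strict order, so over the integers being below or above \<open>t\<close> is
  written with \<open>t - 1\<close> and \<open>t + 1\<close>.\<close>

definition side_guards :: "'k iterm \<Rightarrow> 'k iterm \<Rightarrow> 'k iterm \<Rightarrow> ('k, 'l, 'f, 'p) qf list" where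
  "side_guards x w t =
    [Conj (At (ILe x (IAdd t (INum (-1))))) (At (ILe w (IAdd t (INum (-1))))),
     Conj (At (IEq x t)) (At (IEq w t)),
     Conj (At (ILe (IAdd t (INum 1)) x)) (At (ILe (IAdd t (INum 1)) w))]"

text \<open>Each member chooses one position per term. The disjunction over positions moves into the
  list, so that every guard is a conjunction of atoms, as the premise of a clause must be.\<close>

primrec guards :: "'k iterm \<Rightarrow> 'k iterm \<Rightarrow> 'k iterm list \<Rightarrow> ('k, 'l, 'f, 'p) qf list" where
  "guards x w [] = [Tru]"
| "guards x w (t # ts) = concat (map (\<lambda>s. map (Conj s) (guards x w ts)) (side_guards x w t))"

lemma side_guards_qeval:
  "(\<exists>g\<in>set (side_guards x w t). qeval E \<iota> \<nu> g) \<longleftrightarrow>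
    same_side (ieval \<iota> t) (ieval \<iota> x) (ieval \<iota> w)"
  by (auto simp: side_guards_def same_side_def)

lemma guards_qeval:
  "(\<exists>g\<in>set (guards x w ts). qeval E \<iota> \<nu> g) \<longleftrightarrow>
    (\<forall>t\<in>set ts. same_side (ieval \<iota> t) (ieval \<iota> x) (ieval \<iota> w))"
proof (induction ts)
  case (Cons t ts)
  have "(\<exists>g\<in>set (guards x w (t # ts)). qeval E \<iota> \<nu> g) \<longleftrightarrow>
      (\<exists>g\<in>set (side_guards x w t). qeval E \<iota> \<nu> g) \<and> (\<exists>g\<in>set (guards x w ts). qeval E \<iota> \<nu> g)"
    by auto
  then show ?case by (simp only: Cons.IH side_guards_qeval list.set ball_simps)
qed simp

lemma guards_atom_conj: "g \<in> set (guards x w ts) \<Longrightarrow> atom_conj g"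
  by (induction ts arbitrary: g) (auto simp: side_guards_def)

lemma guards_wt: "g \<in> set (guards x w ts) \<Longrightarrow> wt_qf Sg ls g"
  by (induction ts arbitrary: g) (auto simp: side_guards_def)

lemma guards_ixs:
  "g \<in> set (guards x w ts) \<Longrightarrow> ixs g \<subseteq> set_iterm x \<union> set_iterm w \<union> (\<Union>t\<in>set ts. set_iterm t)"
  by (induction ts arbitrary: g) (auto simp: side_guards_def, blast+)

lemma guards_els: "g \<in> set (guards x w ts) \<Longrightarrow> els g = {}"
  by (induction ts arbitrary: g) (auto simp: side_guards_def)

text \<open>In every atom \<open>x\<close> stands alone on its side; the shifts by one are applied
  to ground terms only.\<close>

lemma guards_index_guard:
  "g \<in> set (guards x w ts) \<Longrightarrow> var_or_ground V x \<Longrightarrow> ground_over V w \<Longrightarrow>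
    \<forall>t\<in>set ts. ground_over V t \<Longrightarrow> index_guard V g"
  by (induction ts arbitrary: g) (auto simp: side_guards_def var_or_ground_def ground_over_def)

section \<open>Representatives of positions\<close>

definition representatives :: "'k iterm list \<Rightarrow> 'k iterm list" where
  "representatives ts =
    INum 0 # concat (map (\<lambda>t. [t, IAdd t (INum 1), IAdd t (INum (-1))]) ts)"

text \<open>If \<open>z\<close> is the value of a term, that term serves. Otherwise, if some values
  are smaller and \<open>d\<close> is the largest of them, \<open>d + 1\<close> serves; if there are
  values but no smaller one, the least value minus one does.\<close>

lemma same_side_representative:
  "\<exists>w\<in>set (representatives ts). \<forall>t\<in>set ts. same_side (ieval \<iota> t) z (ieval \<iota> w)"
proof -
  let ?D = "ieval \<iota> ` set ts"
  have "\<exists>w\<in>set (representatives ts). \<forall>d\<in>?D. same_side d z (ieval \<iota> w)"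
  proof (cases "z \<in> ?D")
    case True
    then obtain t where "t \<in> set ts" "ieval \<iota> t = z" by auto
    then show ?thesis
      by (intro bexI[of _ t]) (auto simp: representatives_def same_side_def)
  next
    case False
    show ?thesis
    proof (cases "\<exists>d\<in>?D. d < z")
      case True
      define d where "d = Max {d \<in> ?D. d < z}"
      have "{d \<in> ?D. d < z} \<noteq> {}" "finite {d \<in> ?D. d < z}" using True by auto
      then have d: "d \<in> {d \<in> ?D. d < z}" "\<And>d'. d' \<in> {d \<in> ?D. d < z} \<Longrightarrow> d' \<le> d"
        unfolding d_def by (rule Max_in[rotated]) (rule Max_ge, simp_all)
      then obtain t where t: "t \<in> set ts" "ieval \<iota> t = d" by auto
      have "same_side d' z (d + 1)" if "d' \<in> ?D" for d'
      proof (cases "d' < z")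
        case True
        then have "d' \<le> d" using that d(2) by simp
        then show ?thesis using True by (simp add: same_side_def)
      next
        case ge: False
        have "d' \<noteq> z" using that \<open>z \<notin> ?D\<close> by metis
        \<comment> \<open>Over the integers \<open>d + 1 \<le> z < d'\<close>.\<close>
        then show ?thesis using ge d(1) by (simp add: same_side_def)
      qed
      then show ?thesis
        using t by (intro bexI[of _ "IAdd t (INum 1)"]) (auto simp: representatives_def)
    next
      case no_lower: False
      show ?thesis
      proof (cases "?D = {}")
        case True
        \<comment> \<open>Without terms every integer has the same position; \<open>INum 0\<close>
          is listed for this case.\<close>
        then show ?thesis by (auto simp: representatives_def)
      next
        case False
        have fin: "finite ?D" by simp
        have "Min ?D \<in> ?D" using fin False by (rule Min_in)
        then obtain t where t: "t \<in> set ts" "ieval \<iota> t = Min ?D" by auto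
        have "same_side d z (Min ?D - 1)" if "d \<in> ?D" for d
        proof -
          have "Min ?D \<le> d" using fin that by (rule Min_le)
          moreover have "d > z" using that no_lower \<open>z \<notin> ?D\<close> by (metis linorder_neqE)
          ultimately show ?thesis by (simp add: same_side_def)
        qed
        then show ?thesis
          using t by (intro bexI[of _ "IAdd t (INum (-1))"]) (auto simp: representatives_def)
      qed
    qed
  qed
  then show ?thesis by blast
qed

lemma representatives_param:
  "\<forall>t\<in>set ts. param_term P t \<Longrightarrow> w \<in> set (representatives ts) \<Longrightarrow> param_term P w"
  by (auto simp: representatives_def param_term_def, blast+)

section \<open>Guarded clauses as formulae of the fragment\<close>

lemma fmeval_univ_fm: "fmeval E A \<iota> \<epsilon> (univ_fm cls) \<longleftrightarrow> (\<forall>cl\<in>set cls. fmeval E A \<iota> \<epsilon> (clause_fm cl))"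
  by (induction cls) (simp_all add: univ_fm_def)

lemma free_ivars_univ_fm: "free_ivars (univ_fm cls) = (\<Union>cl\<in>set cls. free_ivars (clause_fm cl))"
  by (induction cls) (simp_all add: univ_fm_def ileaves_def)

lemma free_evars_univ_fm: "free_evars (univ_fm cls) = (\<Union>cl\<in>set cls. free_evars (clause_fm cl))"
  by (induction cls) (simp_all add: univ_fm_def)

lemma apf_body_univ_fm: "\<forall>cl\<in>set cls. apf_body (clause_fm cl) \<Longrightarrow> apf_body (univ_fm cls)"
  by (induction cls) (auto simp: univ_fm_def intro: apf_body.intros)

definition var0_read :: "('a, 's, 'f, 'p) signature \<Rightarrow> ('c, 'a) sym set \<Rightarrow> ('c, 'a, 's) eleaf \<Rightarrow> bool"
  where "var0_read Sg P r \<longleftrightarrow> (\<exists>g ts. r = Rd (Cur g) ts \<and> Arr g \<in> P \<and> length ts = arity Sg g \<and>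
    (\<forall>t\<in>set ts. t = ILeaf (Var 0) \<or> param_term P t))"

text \<open>The guard compares only the bare variable and ground terms, and in \<open>c\<close> the
  variable survives in reads alone. So the implication is a clause and the matrix of an array
  property at the same time.\<close>

lemma guarded_clause:
  assumes g: "g \<in> set (guards (ILeaf (Var 0)) w ts)" and w: "param_term P w"
    and ts: "\<forall>t\<in>set ts. param_term P t"
    and c: "literal_disj c" "wt_qf Sg (leaf_sort Sg) c" "ixs c \<subseteq> param_leaves P"
      "\<forall>r\<in>els c. var0_read Sg P r"
  shows "clausal (Imp g c)" "wf_matrix Sg P {} 1 (Imp g c)"
    "array_property (AllI 0 (Qf (Imp g c)))"
    "free_ivars (AllI 0 (Qf (Imp g c))) = {}" "free_evars (AllI 0 (Qf (Imp g c))) = {}"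
proof -
  show "clausal (Imp g c)" using c(1) guards_atom_conj[OF g] by simp
  have g_ixs: "ixs g \<subseteq> param_leaves P \<union> {Var 0}"
    using w ts unfolding param_term_def
    by (intro order_trans[OF guards_ixs[OF g]] Un_least UN_least) auto
  have reads: "var0_read Sg P r" if "r \<in> els c" for r
    using c(4) that by simp
  have args: "arg_leaves r \<subseteq> param_leaves P \<union> {Var 0}" if r: "r \<in> els c" for r
  proof -
    obtain h us where "r = Rd (Cur h) us" "\<forall>t\<in>set us. t = ILeaf (Var 0) \<or> param_term P t"
      using reads[OF r] unfolding var0_read_def by (elim exE conjE)
    then show ?thesis by (auto simp: param_term_def)
  qed
  have leaves: "ileaves (Imp g c) \<subseteq> param_leaves P \<union> {Var 0}"
    unfolding ileaves_def qf.set guards_els[OF g] using g_ixs c(3) args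
    by (intro Un_least UN_least) auto
  show "wf_matrix Sg P {} 1 (Imp g c)"
    unfolding wf_matrix_def
  proof (intro conjI ballI)
    show "wt_qf Sg (leaf_sort Sg) (Imp g c)" using guards_wt[OF g] c(2) by simp
    show "case l of Var n \<Rightarrow> n < 1 | Con c \<Rightarrow> IxC c \<in> P | Sk n \<Rightarrow> False"
      if "l \<in> ileaves (Imp g c)" for l
      using subsetD[OF leaves that] by (cases l rule: ileaf.exhaust) auto
    show "case l of EV s n \<Rightarrow> (s, n) \<in> {}
      | Rd a ts \<Rightarrow> \<exists>b. a = Cur b \<and> Arr b \<in> P \<and> length ts = arity Sg b"
      if "l \<in> els (Imp g c)" for l
    proof -
      have "var0_read Sg P l" using that guards_els[OF g] by (intro reads) simp
      then show ?thesis by (auto simp: var0_read_def)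
    qed
  qed
  have ground: "ground_over {0} t" if "param_term P t" for t
    using that by (auto simp: ground_over_def param_term_def)
  have "index_guard {0} g"
    using w ts by (intro guards_index_guard[OF g]) (auto simp: ground var_or_ground_def)
  moreover have "value_constraint {0} c"
    unfolding value_constraint_def
  proof (intro conjI allI impI ballI)
    show "ixs c \<inter> Var ` {0} = {}" using c(3) by auto
    fix a us t assume "Rd a us \<in> els c" "t \<in> set us"
    then have "t = ILeaf (Var 0) \<or> param_term P t"
      using reads[of "Rd a us"] by (auto simp: var0_read_def)
    then show "var_or_ground {0} t" using ground by (auto simp: var_or_ground_def)
  qed
  ultimately show "array_property (AllI 0 (Qf (Imp g c)))"
    using array_property.intros[of "[0]" g c] by (simp add: alls_def)
  have "n = 0" if "Var n \<in> ileaves (Imp g c)" for n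
    using subsetD[OF leaves that] by simp
  then show "free_ivars (AllI 0 (Qf (Imp g c))) = {}" by auto
  have "EV s n \<notin> els (Imp g c)" for s n
    using reads[of "EV s n"] guards_els[OF g] by (simp add: var0_read_def) blast
  then show "free_evars (AllI 0 (Qf (Imp g c))) = {}" by auto
qed

definition var0_subst :: "'c ileaf iterm \<Rightarrow> 'c ileaf \<Rightarrow> 'c ileaf iterm" where
  "var0_subst w l = (if l = Var 0 then w else ILeaf l)"

text \<open>Only the index atoms are instantiated: the reads stay functions of the quantified variable.\<close>

definition guarded_clauses :: "'c ileaf iterm list \<Rightarrow> ('c, 'a, 's, 'f, 'p) xqf \<Rightarrow>
    ('c, 'a, 's, 'f, 'p) uclause list" where
  "guarded_clauses ts \<phi> = concat (map (\<lambda>w. concat (map (\<lambda>g. map (\<lambda>c. (1, Imp g c))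
      (cnf False (qsubst (var0_subst w) id \<phi>))) (guards (ILeaf (Var 0)) w ts))) (representatives ts))"

lemma set_guarded_clauses:
  "set (guarded_clauses ts \<phi>) = {(1, Imp g c) | w g c. w \<in> set (representatives ts) \<and>
    g \<in> set (guards (ILeaf (Var 0)) w ts) \<and> c \<in> set (cnf False (qsubst (var0_subst w) id \<phi>))}"
  by (auto simp: guarded_clauses_def)

text \<open>Putting a representative for the variable makes the index atoms ground. Occurrences of
  the variable under divisibility or arithmetic, which the fragment forbids, disappear in this
  way.\<close>

lemma guarded_clauses_fragment:
  assumes ts: "\<forall>t\<in>set ts. param_term P t"
    and \<phi>: "wt_qf Sg (leaf_sort Sg) \<phi>" "ixs \<phi> \<subseteq> param_leaves P \<union> {Var 0}"
      "\<forall>r\<in>els \<phi>. var0_read Sg P r"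
  shows "wf_clauses Sg P (guarded_clauses ts \<phi>)" "one_var_clauses (guarded_clauses ts \<phi>)"
    "array_property_fragment (univ_fm (guarded_clauses ts \<phi>))"
proof -
  let ?\<Delta> = "guarded_clauses ts \<phi>"
  have *: "\<exists>M. cl = (1, M) \<and> clausal M \<and> wf_matrix Sg P {} 1 M \<and>
      array_property (AllI 0 (Qf M)) \<and> free_ivars (AllI 0 (Qf M)) = {} \<and>
      free_evars (AllI 0 (Qf M)) = {}" if "cl \<in> set ?\<Delta>" for cl
  proof -
    obtain w g c where cl: "cl = (1, Imp g c)" and w: "w \<in> set (representatives ts)"
      and g: "g \<in> set (guards (ILeaf (Var 0)) w ts)"
      and c: "c \<in> set (cnf False (qsubst (var0_subst w) id \<phi>))"
      using \<open>cl \<in> set ?\<Delta>\<close> unfolding set_guarded_clauses by blast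
    have w': "param_term P w" using ts w by (rule representatives_param)
    have lit: "literal_disj c" using c by (rule cnf_literal_disj)
    have wt: "wt_qf Sg (leaf_sort Sg) c" using \<phi>(1) by (intro cnf_wt[OF c]) simp
    have "set_iterm (var0_subst w l) \<subseteq> param_leaves P" if "l \<in> ixs \<phi>" for l
      using w' subsetD[OF \<phi>(2) that] by (auto simp: var0_subst_def param_term_def)
    then have "ixs (qsubst (var0_subst w) id \<phi>) \<subseteq> param_leaves P"
      unfolding ixs_qsubst by (rule UN_least)
    then have ixs: "ixs c \<subseteq> param_leaves P" using cnf_ixs[OF c] by (auto simp only:)
    have els: "\<forall>r\<in>els c. var0_read Sg P r"
      using \<phi>(3) cnf_els[OF c] by simp
    show ?thesis
      using cl guarded_clause[OF g w' ts lit wt ixs els] by (intro exI[of _ "Imp g c"]) simp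
  qed
  show "wf_clauses Sg P ?\<Delta>" "one_var_clauses ?\<Delta>"
    using * by (fastforce simp: wf_clauses_def one_var_clauses_def)+
  have "apf_body (clause_fm cl) \<and> free_ivars (clause_fm cl) = {} \<and> free_evars (clause_fm cl) = {}"
    if "cl \<in> set ?\<Delta>" for cl
  proof -
    obtain M where "cl = (1, M)" "array_property (AllI 0 (Qf M))"
      "free_ivars (AllI 0 (Qf M)) = {}" "free_evars (AllI 0 (Qf M)) = {}"
      using *[OF \<open>cl \<in> set ?\<Delta>\<close>] by (elim exE conjE)
    then show ?thesis using apf_body.intros(2) by (simp add: alls_def)
  qed
  then show "array_property_fragment (univ_fm ?\<Delta>)"
    unfolding array_property_fragment_def free_ivars_univ_fm free_evars_univ_fm
    by (intro conjI ex_apf.intros(1) apf_body_univ_fm) simp_all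
qed

section \<open>Equivalence of the guarded clauses with the quantified negation\<close>

lemma sorted_val_read_val: "sorted_interp Sg E A \<epsilon> \<Longrightarrow> sorted_val Sg E (read_val A \<iota> \<epsilon>)"
  unfolding sorted_val_def
proof
  fix l assume "sorted_interp Sg E A \<epsilon>"
  then show "read_val A \<iota> \<epsilon> l \<in> carr E (leaf_sort Sg l)"
    by (cases l) (simp_all add: sorted_interp_def)
qed

text \<open>Some guard for \<open>w\<close> holds exactly when the variable and \<open>w\<close>
  have the same position, and then invariance makes the instance at \<open>w\<close> equivalent to
  \<open>\<phi>\<close>. Since some representative always matches, the clauses together say that
  \<open>\<phi>\<close> fails.\<close>

lemma guarded_clauses_fmeval:
  assumes ts: "\<forall>t\<in>set ts. param_term P t"
    and inv: "order_invariant Sg TE (Var 0) (set ts) \<phi>"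
    and E: "E \<in> TE" and A: "sorted_interp Sg E A \<epsilon>"
  shows "fmeval E A \<iota> \<epsilon> (univ_fm (guarded_clauses ts \<phi>)) \<longleftrightarrow>
    fmeval E A \<iota> \<epsilon> (AllI 0 (Qf (Neg \<phi>)))"
proof -
  have "(\<forall>w\<in>set (representatives ts). \<forall>g\<in>set (guards (ILeaf (Var 0)) w ts).
        \<forall>c\<in>set (cnf False (qsubst (var0_subst w) id \<phi>)).
          qeval E \<kappa> (read_val A \<kappa> \<epsilon>) g \<longrightarrow> qeval E \<kappa> (read_val A \<kappa> \<epsilon>) c) \<longleftrightarrow>
      \<not> qeval E \<kappa> (read_val A \<kappa> \<epsilon>) \<phi>" (is "?L \<longleftrightarrow> _") for \<kappa>
  proof -
    let ?\<nu> = "read_val A \<kappa> \<epsilon>"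
    have eq: "qeval E \<kappa> ?\<nu> (qsubst (var0_subst w) id \<phi>) = qeval E \<kappa> ?\<nu> \<phi>"
      if side: "\<forall>t\<in>set ts. same_side (ieval \<kappa> t) (\<kappa> (Var 0)) (ieval \<kappa> w)" for w
    proof -
      \<comment> \<open>Substituting in index atoms alone changes only the index valuation; the
        reads remain evaluated at the variable. This is why invariance was stated for a fixed
        valuation of the reads.\<close>
      have "(\<lambda>l. ieval \<kappa> (var0_subst w l)) = \<kappa>(Var 0 := ieval \<kappa> w)"
        by (auto simp: var0_subst_def)
      then have "qeval E \<kappa> ?\<nu> (qsubst (var0_subst w) id \<phi>) = qeval E (\<kappa>(Var 0 := ieval \<kappa> w)) ?\<nu> \<phi>"
        by simp
      also have "\<dots> = qeval E (\<kappa>(Var 0 := \<kappa> (Var 0))) ?\<nu> \<phi>"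
        by (rule order_invariantD[OF inv E sorted_val_read_val[OF A], symmetric]) (rule side)
      finally show ?thesis by simp
    qed
    have "?L \<longleftrightarrow> (\<forall>w\<in>set (representatives ts).
        (\<exists>g\<in>set (guards (ILeaf (Var 0)) w ts). qeval E \<kappa> ?\<nu> g) \<longrightarrow>
        (\<forall>c\<in>set (cnf False (qsubst (var0_subst w) id \<phi>)). qeval E \<kappa> ?\<nu> c))"
      by blast
    also have "\<dots> \<longleftrightarrow> (\<forall>w\<in>set (representatives ts).
        (\<forall>t\<in>set ts. same_side (ieval \<kappa> t) (\<kappa> (Var 0)) (ieval \<kappa> w)) \<longrightarrow>
        \<not> qeval E \<kappa> ?\<nu> (qsubst (var0_subst w) id \<phi>))"
      unfolding guards_qeval cnf_qeval by simp
    also have "\<dots> \<longleftrightarrow> (\<forall>w\<in>set (representatives ts).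
        (\<forall>t\<in>set ts. same_side (ieval \<kappa> t) (\<kappa> (Var 0)) (ieval \<kappa> w)) \<longrightarrow>
        \<not> qeval E \<kappa> ?\<nu> \<phi>)"
      using eq by metis
    \<comment> \<open>The premise on positions holds for at least one representative.\<close>
    also have "\<dots> \<longleftrightarrow> \<not> qeval E \<kappa> ?\<nu> \<phi>"
      using same_side_representative[of ts \<kappa> "\<kappa> (Var 0)"] by blast
    finally show ?thesis .
  qed
  note key = this
  have "fmeval E A \<iota> \<epsilon> (univ_fm (guarded_clauses ts \<phi>)) \<longleftrightarrow>
      (\<forall>z. \<forall>w\<in>set (representatives ts). \<forall>g\<in>set (guards (ILeaf (Var 0)) w ts).
        \<forall>c\<in>set (cnf False (qsubst (var0_subst w) id \<phi>)).
          qeval E (\<iota>(Var 0 := z)) (read_val A (\<iota>(Var 0 := z)) \<epsilon>) g \<longrightarrow>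
          qeval E (\<iota>(Var 0 := z)) (read_val A (\<iota>(Var 0 := z)) \<epsilon>) c)"
    unfolding fmeval_univ_fm by (auto simp: guarded_clauses_def alls_def simp del: fun_upd_apply)
  then show ?thesis unfolding key by simp
qed

text \<open>For the case that \<Gamma> has no quantified variable, whereas the guarded clauses
  always quantify over \<open>Var 0\<close>.\<close>

lemma fmeval_vacuous_AllI:
  assumes "Var n \<notin> ileaves M"
  shows "fmeval E A \<iota> \<epsilon> (AllI n (Qf M)) \<longleftrightarrow> fmeval E A \<iota> \<epsilon> (Qf M)"
proof -
  have "read_val A (\<iota>(Var n := z)) \<epsilon> r = read_val A \<iota> \<epsilon> r" if r: "r \<in> els M" for z r
  proof -
    have "Var n \<notin> arg_leaves r" using assms r by (auto simp: ileaves_def)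
    then show ?thesis
      by (cases r rule: eleaf.exhaust)
        (auto intro!: arg_cong[of _ _ "A _"] map_cong ieval_cong)
  qed
  then have "qeval E (\<iota>(Var n := z)) (read_val A (\<iota>(Var n := z)) \<epsilon>) M =
      qeval E \<iota> (read_val A \<iota> \<epsilon>) M" for z
    using assms by (intro qeval_cong) (auto simp: ileaves_def)
  then show ?thesis by simp
qed

section \<open>From Skolem constants back to quantified clauses\<close>

lemma unskolem_order_invariant:
  fixes \<theta> :: "('c, 'a, 's, 'f, 'p) xqf" and TE :: "('s, 'f, 'p, 'u) estruct set"
  assumes inv: "order_invariant Sg TE (Sk 0) W \<theta>" and W: "\<forall>t\<in>W. param_term P t"
    and ixs: "ixs \<theta> \<subseteq> param_leaves P \<union> {Sk 0}"
  shows "order_invariant Sg TE (Var 0) W (xsubst unskolem \<theta>)"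
  unfolding order_invariant_def
proof (intro ballI allI impI)
  fix E \<iota> z z' and \<nu> :: "('c, 'a, 's) eleaf \<Rightarrow> 'u"
  assume E: "E \<in> TE" and \<nu>: "sorted_val Sg E \<nu>" and side: "\<forall>t\<in>W. same_side (ieval \<iota> t) z z'"
  \<comment> \<open>On the index atoms of \<open>\<theta>\<close>, updating \<open>Var 0\<close>
    after the renaming agrees with updating \<open>Sk 0\<close> before it, and parameters are
    untouched.\<close>
  have eq: "qeval E (\<iota>(Var 0 := y)) \<nu> (xsubst unskolem \<theta>) =
      qeval E (\<iota>(Sk 0 := y)) (\<lambda>l. \<nu> (lsubst unskolem l)) \<theta>" for y
    unfolding xsubst_def qeval_qsubst
  proof (rule qeval_cong)
    fix l assume "l \<in> ixs \<theta>"
    with ixs have "l \<in> param_leaves P \<or> l = Sk 0" by auto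
    then show "ieval (\<iota>(Var 0 := y)) (unskolem l) = (\<iota>(Sk 0 := y)) l"
      by auto
  qed simp
  show "qeval E (\<iota>(Var 0 := z)) \<nu> (xsubst unskolem \<theta>) =
      qeval E (\<iota>(Var 0 := z')) \<nu> (xsubst unskolem \<theta>)"
    unfolding eq by (rule order_invariantD[OF inv E sorted_val_lsubst[OF \<nu>] side])
qed

text \<open>The terms that witness the invariance of \<open>\<theta>\<close> are listed as
  \<open>ts\<close>, and their guarded clauses are the required ones.\<close>

lemma simple_qf_representation:
  fixes \<theta> :: "('c, 'a, 's, 'f, 'p) xqf" and TE :: "('s, 'f, 'p, 'u) estruct set"
  assumes \<theta>: "simple_qf Sg TE P m \<theta>" and m: "m \<le> 1" and wt: "wt_qf Sg (leaf_sort Sg) \<theta>"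
    and els: "\<forall>r\<in>els \<theta>. \<exists>g ts. r = Rd (Cur g) ts \<and> Arr g \<in> P"
  shows "\<exists>\<Delta>. wf_clauses Sg P \<Delta> \<and> one_var_clauses \<Delta> \<and> array_property_fragment (univ_fm \<Delta>) \<and>
    equivalent Sg TE (clause_fm (m, Neg (xsubst unskolem \<theta>))) (univ_fm \<Delta>)"
proof -
  obtain W where W: "finite W" "\<forall>t\<in>W. param_term P t" "order_invariant Sg TE (Sk 0) W \<theta>"
    using \<theta> by (rule simple_qfE)
  obtain ts where ts: "set ts = W" using finite_list[OF W(1)] by blast
  let ?\<phi> = "xsubst unskolem \<theta>"
  have "Sk ` {..<m} \<subseteq> {Sk 0}" using m by auto
  moreover have "ixs \<theta> \<subseteq> param_leaves P \<union> Sk ` {..<m}" using \<theta> by (simp add: simple_qf_def)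
  ultimately have ixs: "ixs \<theta> \<subseteq> param_leaves P \<union> {Sk 0}" by blast
  have inv: "order_invariant Sg TE (Var 0) (set ts) ?\<phi>"
    unfolding ts by (rule unskolem_order_invariant[OF W(3,2) ixs])
  have "set_iterm (unskolem l) \<subseteq> param_leaves P \<union> {Var 0}" if "l \<in> ixs \<theta>" for l
    using subsetD[OF ixs that] by auto
  then have \<phi>_ixs: "ixs ?\<phi> \<subseteq> param_leaves P \<union> {Var 0}"
    unfolding xsubst_def ixs_qsubst by (rule UN_least)
  have arg: "isubst unskolem t = ILeaf (Var 0) \<or> param_term P (isubst unskolem t)"
    if t: "simple_term P m t" for t
  proof (cases "param_term P t")
    case True
    then have "isubst unskolem t = t"
      by (intro isubst_id_on) (auto simp: param_term_def)
    with True show ?thesis by simp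
  next
    case False
    then have "t = ILeaf (Sk 0)" using t m by (auto simp: simple_term_def)
    then show ?thesis by simp
  qed
  have \<phi>_els: "\<forall>r\<in>els ?\<phi>. var0_read Sg P r"
  proof
    fix r assume "r \<in> els ?\<phi>"
    then obtain r' where r': "r = lsubst unskolem r'" "r' \<in> els \<theta>"
      unfolding xsubst_def els_qsubst by (elim imageE)
    then obtain g us where us: "r' = Rd (Cur g) us" "Arr g \<in> P" using els by blast
    have "length us = arity Sg g \<and> (\<forall>t\<in>set us. simple_term P m t)"
      using simple_readsD[OF simple_qf_reads[OF \<theta>], of "Cur g" us] r'(2) us(1) by simp
    then show "var0_read Sg P r"
      using r'(1) us arg by (simp add: var0_read_def)
  qed
  have \<phi>_wt: "wt_qf Sg (leaf_sort Sg) ?\<phi>" using wt by simp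
  have P: "\<forall>t\<in>set ts. param_term P t" using W(2) ts by simp
  \<comment> \<open>For \<open>m = 0\<close> a vacuous quantifier is added, so that both cases take
    the form treated by \<open>guarded_clauses_fmeval\<close>.\<close>
  have clause: "fmeval E A \<iota> \<epsilon> (clause_fm (m, Neg ?\<phi>)) = fmeval E A \<iota> \<epsilon> (AllI 0 (Qf (Neg ?\<phi>)))"
    for E :: "('s, 'f, 'p, 'u) estruct" and A \<iota> \<epsilon>
  proof (cases "m = 0")
    case True
    have "ileaves \<theta> \<subseteq> param_leaves P" using simple_qf_ileaves[OF \<theta>] True by simp
    then have "Var 0 \<notin> set_iterm (unskolem l)" if "l \<in> ileaves \<theta>" for l
      using subsetD[OF _ that] by (fastforce simp: unskolem_def param_leaves_def)
    then have vacuous: "Var 0 \<notin> ileaves (Neg ?\<phi>)"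
      unfolding ileaves_Neg ileaves_xsubst by blast
    have "clause_fm (m, Neg ?\<phi>) = Qf (Neg ?\<phi>)" by (simp add: True alls_def)
    then show ?thesis by (simp only:) (rule fmeval_vacuous_AllI[OF vacuous, symmetric])
  next
    case False
    then have "m = 1" using m by simp
    then show ?thesis by (simp add: alls_def)
  qed
  have "equivalent Sg TE (clause_fm (m, Neg ?\<phi>)) (univ_fm (guarded_clauses ts ?\<phi>))"
    unfolding equivalent_def entails_def
    using guarded_clauses_fmeval[OF P inv] clause by simp
  with guarded_clauses_fragment[OF P \<phi>_wt \<phi>_ixs \<phi>_els] show ?thesis by blast
qed

section \<open>The computed formulae in array property form\<close>

theorem theorem17:
  fixes Sg :: "('a, 's, 'f, 'p) signature"
    and TE :: "('s, 'f, 'p, 'u) estruct set"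
    and T :: "('c, 'a, 's, 'f, 'p) transsys"
    and \<Psi> :: "('c, 'a, 's, 'f, 'p) uclause list"
    and \<Gamma> :: "('c, 'a, 's, 'f, 'p) uclause"
    and n :: nat
  assumes "element_theory Sg TE"
    and "transition_system Sg TE T"
    and "\<forall>s\<in>NonParam T. sym_arity Sg s = 1"
    and "wf_clauses Sg (Param T) \<Psi>"
    and "array_property_fragment (univ_fm (Axs T))"
    and "array_property_fragment (univ_fm (Init T))"
    and "array_property_fragment (univ_fm (Update Sg T))"
    and "array_property_fragment (univ_fm \<Psi>)"
    and "one_var_clauses \<Psi>"
    and "generated Sg TE T \<Psi> n \<Gamma>"
  shows "\<exists>\<Delta>. wf_clauses Sg (Param T) \<Delta> \<and> one_var_clauses \<Delta> \<and>
           array_property_fragment (univ_fm \<Delta>) \<and>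
           equivalent Sg TE (clause_fm \<Gamma>) (univ_fm \<Delta>)"
proof -
  \<comment> \<open>Index constants have arity 0, so none of them is among the unary symbols of
    \<Sigma>.\<close>
  have param: "IxC c \<in> Param T" if "IxC c \<in> Param T \<union> NonParam T" for c
    using assms(3) that by fastforce
  have "wf_clauses Sg (Param T \<union> NonParam T) (Axs T)"
    using assms(2) by (simp add: transition_system_def Let_def)
  then have K: "\<forall>cl\<in>set (Axs T). simple_clause Sg TE (Param T) cl"
    using assms(5) param by (rule simple_clauses_wf)
  have U: "\<forall>cl\<in>set (Update Sg T). simple_clause Sg TE (Param T) cl"
    using assms(2) param assms(7) by (rule update_simple)
  have "\<forall>cl\<in>set \<Psi>. simple_clause Sg TE (Param T) cl"
    by (rule simple_clauses_wf[OF assms(4,8)])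
  then have \<Psi>: "\<forall>cl\<in>set \<Psi>. simple_clause Sg TE (Param T) cl \<and> fst cl \<le> 1"
    using assms(9) by (auto simp: one_var_clauses_def)
  obtain I where I: "iterate Sg TE T \<Psi> n I" "symbol_elimination Sg TE T I \<Gamma>"
    using assms(10) by (cases rule: generated.cases)
  have "\<forall>cl\<in>set I. simple_clause Sg TE (Param T) cl \<and> fst cl \<le> 1"
    using iterate_simple[OF I(1) K U \<Psi>] .
  then have "\<forall>cl\<in>set I. simple_clause Sg TE (Param T) cl" "\<forall>(k, M)\<in>set I. k \<le> 1" by auto
  from symbol_elimination_simple[OF K U this I(2)]
  obtain m \<theta> where "m \<le> 1" and \<Gamma>: "\<Gamma> = (m, Neg (xsubst unskolem \<theta>))"
    and "simple_qf Sg TE (Param T) m \<theta>" "wt_qf Sg (leaf_sort Sg) \<theta>"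
      "\<forall>r\<in>els \<theta>. \<exists>g ts. r = Rd (Cur g) ts \<and> Arr g \<in> Param T"
    by (elim exE conjE)
  then show ?thesis unfolding \<Gamma> by (intro simple_qf_representation)
qed

end
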